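(* Given a double category $\mathbb{C}$, an object $\hat{x}$ in $\mathbb{C}$, and a lax double presheaf $X\colon \mathbb{C}^{\mathrm{op}}\to \mathbb{C}\mathrm{at}$, there is an isomorphism of categories \[ \mathcal{P}_{\mathbb{C}}(\mathbb{C}(-,\hat{x}),X)\cong X\hat{x}, \] which is $2$-natural in $\hat{x}$ (in $\mathbf{H}\mathbb{C}$) and in $X$ (in $\mathcal{P}_{\mathbb{C}}$). Here $\mathcal{P}_{\mathbb{C}}=[\mathbb{C}^{\mathrm{op}},\mathbb{C}\mathrm{at}]^{\mathrm{nlax}}$ is the $2$-category of (normal) lax double presheaves over $\mathbb{C}$, horizontal transformations, and globular modifications.
   Context: **Double categories.** A (strict) double category $\mathbb{C}$ has objects; horizontal morphisms $f\colon x\to y$ (composition $g\circ f$, identities $1_x$); vertical morphisms $u\colon x\nrightarrow x'$ (composition $u'\bullet u$, identities $e_x$); and squares $\alpha\colon[u\,{}^{f}_{f'}\,v]$ with left boundary $u\colon x\nrightarrow x'$, right boundary $v\colon y\nrightarrow y'$, top $f\colon x\to y$ and bottom $f'\colon x'\to y'$. Squares compose horizontally ($\beta\circ\alpha$, along a common vertical morphism, identities $1_u$) and vertically ($\alpha'\bullet\alpha$, along a common horizontal morphism, identities $e_f$). All compositions are strictly associative and unital, satisfy interchange, and $e_g\circ e_f=e_{g\circ f}$, $1_{u'}\bullet 1_u=1_{u'\bullet u}$, $e_{1_x}=1_{e_x}$. A square is globular if both its vertical boundaries are vertical identities. $\mathbf{H}\mathbb{C}$ is the $2$-category of objects, horizontal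 morphisms and globular squares of $\mathbb{C}$. $\mathbb{C}^{\mathrm{op}}$ is obtained by reversing horizontal morphisms and squares horizontally. **Profunctors.** A profunctor $U\colon \mathcal{A}\nrightarrow\mathcal{A}'$ is a functor $\mathcal{A}^{\mathrm{op}}\times\mathcal{A}'\to\mathrm{Set}$. Composition: $(U'\bullet U)(a,a'')=\int^{a'}U'(a',a'')\times U(a,a')$; the class of $(s',s)$ is $[s',s]$. The identity profunctor is the hom functor, and one chooses $U\bullet e_{\mathcal{A}}=U=e_{\mathcal{A}'}\bullet U$ via the co-Yoneda isomorphisms. $\mathbb{C}\mathrm{at}$ is the weak double category of small categories, functors (horizontal), profunctors (vertical), with squares $[U\,{}^{F}_{F'}\,V]$ the natural transformations $U\Rightarrow V(F^{\mathrm{op}}\times F')$. **Lax double presheaves.** A lax double presheaf over $\mathbb{C}$ is a normal lax double functor $X\colon\mathbb{C}^{\mathrm{op}}\to\mathbb{C}\mathrm{at}$ (lax in the vertical direction). Explicitly: a category $Xx$ for each object $x$; a functor $Xf\colon Xy\to Xx$ for each horizontal $f\colon x\to y$; a profunctor $Xu\colon Xx^{\mathrm{op}}\times Xx'\to\mathrm{Set}$ for each vertical $u\colon x\nrightarrow x'$; a natural transformation $X\alpha\colon Xv\Rightarrow Xu(Xf^{\mathrm{op}}\times Xf')$ for each square $\alpha\colon[u\,{}^{f}_{f'}\,v]$; and a natural transformation $\mu_{u,u'}\colon Xu'\bullet Xu\Rightarrow X(u'\bullet u)$ for all composable vertical $u,u'$; such that (i) horizontal compositions and identities (of horizontal morphisms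 and of squares) are preserved strictly; (ii) $\mu$ is natural: $X(\alpha'\bullet\alpha)\circ\mu_{v,v'}=\mu_{u,u'}(Xf^{\mathrm{op}}\times Xf'')\circ(X\alpha'\bullet X\alpha)$ for vertically composable squares $\alpha\colon[u\,{}^{f}_{f'}\,v]$, $\alpha'\colon[u'\,{}^{f'}_{f''}\,v']$, and $\mu$ is associative: $\mu_{u,u''\bullet u'}\circ(\mu_{u',u''}\bullet Xu)=\mu_{u'\bullet u,u''}\circ(Xu''\bullet\mu_{u,u'})$ up to the associator of profunctor composition; (iii) normality: $Xe_x$ is the hom functor of $Xx$, $Xe_f$ is the action of the functor $Xf$ on homs, and $\mu_{e_x,u}$, $\mu_{u,e_{x'}}$ are identities at $Xu$. For a globular square $\eta\colon[e_x\,{}^{g}_{g'}\,e_{\hat x}]$, $X\eta$ is identified with the natural transformation $Xg\Rightarrow Xg'\colon X\hat x\to Xx$ with component $(X\eta)_{a,a}(1_a)$ at $a$. **Horizontal transformations** $F\colon X\Rightarrow Y$: functors $F_x\colon Xx\to Yx$ and natural transformations $F_u\colon Xu\Rightarrow Yu(F_x^{\mathrm{op}}\times F_{x'})$ such that $F_x\circ Xf=Yf\circ F_y$ for $f\colon x\to y$; $F_u(Xf^{\mathrm{op}}\times Xf')\circ X\alpha=Y\alpha(F_y^{\mathrm{op}}\times F_{y'})\circ F_v$ for each square $\alpha\colon[u\,{}^{f}_{f'}\,v]$; $F_{u'\bullet u}\circ\mu_{u,u'}=\mu_{u,u'}(F_x^{\mathrm{op}}\times F_{x''})\circ(F_{u'}\bullet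 F_u)$; and $F_{e_x}$ is the action of $F_x$ on homs. **Globular modifications** $A$ from $F$ to $F'$ (both $X\Rightarrow Y$): natural transformations $A_x\colon F_x\Rightarrow F'_x$ such that $Yf\,A_y=A_x\,Xf$ for all $f\colon x\to y$, and for every $u\colon x\nrightarrow x'$, $Yu(F_x^{\mathrm{op}}\times A_{x'})\circ F_u=Yu(A_x^{\mathrm{op}}\times F'_{x'})\circ F'_u$. These form the $2$-category $\mathcal{P}_{\mathbb{C}}$ (compositions componentwise), whose hom categories are $\mathcal{P}_{\mathbb{C}}(X,Y)$. **Representables.** $\mathbb{C}(-,\hat x)\colon\mathbb{C}^{\mathrm{op}}\to\mathbb{C}\mathrm{at}$ sends $x$ to the category $\mathbb{C}(x,\hat x)$ of horizontal morphisms $g\colon x\to\hat x$ and globular squares $[e_x\,{}^{g}_{g'}\,e_{\hat x}]$ under vertical composition; $f\colon x\to y$ to the functor of precomposition with $f$ and $e_f$; $u\colon x\nrightarrow x'$ to the profunctor with $\mathbb{C}(u,\hat x)(g,g')$ the set of squares $[u\,{}^{g}_{g'}\,e_{\hat x}]$, acted on by vertical composition; a square $\alpha$ to horizontal precomposition $\eta\mapsto\eta\circ\alpha$; and $\mu_{u,u'}$ is $[\alpha',\alpha]\mapsto\alpha'\bullet\alpha$. A horizontal morphism $\hat f\colon\hat x\to\hat y$ induces a horizontal transformation $\mathbb{C}(-,\hat f)$ by postcomposition with $\hat f$ and $e_{\hat f}$, and a globular square $\hat\alpha\colon[e_{\hat x}\,{}^{\hat f}_{\hat f'}\,e_{\hat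 y}]$ a globular modification $\mathbb{C}(-,\hat\alpha)$ whose component at $x$ and $g\colon x\to\hat x$ is $\hat\alpha\circ e_g$. **$2$-naturality** refers to the $2$-functors $(\hat x,X)\mapsto\mathcal{P}_{\mathbb{C}}(\mathbb{C}(-,\hat x),X)$ and $(\hat x,X)\mapsto X\hat x$, contravariant on horizontal morphisms of $\mathbf{H}\mathbb{C}$ and covariant in $\mathcal{P}_{\mathbb{C}}$, with values in $\mathrm{Cat}$; in the second, $\hat f$, $\hat\alpha$, $F$, $A$ act by $X\hat f$, $X\hat\alpha$, $F_{\hat x}$, $A_{\hat x}$. *)

theory Defs
  imports "HOL-Library.FuncSet"
begin

section \<open>Categories, functors, natural transformations\<close>

text \<open>
  All structures have explicit carrier sets. Only the values of the operations on the carriers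
  matter; \<open>Comp A g f\<close> is the composite "first \<open>f\<close>, then \<open>g\<close>".
\<close>

record ('o, 'm) cat =
  Obj :: "'o set"
  Arr :: "'m set"
  Dom :: "'m \<Rightarrow> 'o"
  Cod :: "'m \<Rightarrow> 'o"
  Ident :: "'o \<Rightarrow> 'm"
  Comp :: "'m \<Rightarrow> 'm \<Rightarrow> 'm"

definition hom :: "('o, 'm) cat \<Rightarrow> 'o \<Rightarrow> 'o \<Rightarrow> 'm set" where
  "hom A a b = {m \<in> Arr A. Dom A m = a \<and> Cod A m = b}"

locale category =
  fixes A :: "('o, 'm) cat"
  assumes dom_obj: "\<And>f. f \<in> Arr A \<Longrightarrow> Dom A f \<in> Obj A"
    and cod_obj: "\<And>f. f \<in> Arr A \<Longrightarrow> Cod A f \<in> Obj A"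
    and ident_hom: "\<And>a. a \<in> Obj A \<Longrightarrow> Ident A a \<in> hom A a a"
    and comp_hom: "\<And>f g a b c. f \<in> hom A a b \<Longrightarrow> g \<in> hom A b c \<Longrightarrow> Comp A g f \<in> hom A a c"
    and ident_left: "\<And>f a b. f \<in> hom A a b \<Longrightarrow> Comp A (Ident A b) f = f"
    and ident_right: "\<And>f a b. f \<in> hom A a b \<Longrightarrow> Comp A f (Ident A a) = f"
    and comp_assoc: "\<And>f g h a b c d. f \<in> hom A a b \<Longrightarrow> g \<in> hom A b c \<Longrightarrow> h \<in> hom A c d \<Longrightarrow>
      Comp A h (Comp A g f) = Comp A (Comp A h g) f"

record ('a, 'm, 'b, 'n) func =
  fob :: "'a \<Rightarrow> 'b"
  far :: "'m \<Rightarrow> 'n"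

definition is_functor :: "('a, 'm) cat \<Rightarrow> ('b, 'n) cat \<Rightarrow> ('a, 'm, 'b, 'n) func \<Rightarrow> bool" where
  "is_functor A B F \<longleftrightarrow>
     (\<forall>a \<in> Obj A. fob F a \<in> Obj B) \<and>
     (\<forall>a \<in> Obj A. \<forall>b \<in> Obj A. \<forall>f \<in> hom A a b. far F f \<in> hom B (fob F a) (fob F b)) \<and>
     (\<forall>a \<in> Obj A. far F (Ident A a) = Ident B (fob F a)) \<and>
     (\<forall>a b c f g. f \<in> hom A a b \<longrightarrow> g \<in> hom A b c \<longrightarrow>
        far F (Comp A g f) = Comp B (far F g) (far F f))"

definition id_func :: "('a, 'm, 'a, 'm) func" where
  "id_func = \<lparr>fob = (\<lambda>a. a), far = (\<lambda>m. m)\<rparr>"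

definition func_comp ::
  "('b, 'n, 'c, 'l) func \<Rightarrow> ('a, 'm, 'b, 'n) func \<Rightarrow> ('a, 'm, 'c, 'l) func" where
  "func_comp G F = \<lparr>fob = (\<lambda>a. fob G (fob F a)), far = (\<lambda>m. far G (far F m))\<rparr>"

definition func_eq ::
  "('a, 'm) cat \<Rightarrow> ('a, 'm, 'b, 'n) func \<Rightarrow> ('a, 'm, 'b, 'n) func \<Rightarrow> bool" where
  "func_eq A F G \<longleftrightarrow> (\<forall>a \<in> Obj A. fob F a = fob G a) \<and> (\<forall>m \<in> Arr A. far F m = far G m)"

definition func_restrict :: "('a, 'm) cat \<Rightarrow> ('a, 'm, 'b, 'n) func \<Rightarrow> ('a, 'm, 'b, 'n) func" where
  "func_restrict A F = \<lparr>fob = restrict (fob F) (Obj A), far = restrict (far F) (Arr A)\<rparr>"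

definition func_extensional :: "('a, 'm) cat \<Rightarrow> ('a, 'm, 'b, 'n) func \<Rightarrow> bool" where
  "func_extensional A F \<longleftrightarrow> fob F \<in> extensional (Obj A) \<and> far F \<in> extensional (Arr A)"

definition nat_trans :: "('a, 'm) cat \<Rightarrow> ('b, 'n) cat \<Rightarrow>
    ('a, 'm, 'b, 'n) func \<Rightarrow> ('a, 'm, 'b, 'n) func \<Rightarrow> ('a \<Rightarrow> 'n) \<Rightarrow> bool" where
  "nat_trans A B F G \<eta> \<longleftrightarrow>
     (\<forall>a \<in> Obj A. \<eta> a \<in> hom B (fob F a) (fob G a)) \<and>
     (\<forall>a b. \<forall>f \<in> hom A a b. Comp B (\<eta> b) (far F f) = Comp B (far G f) (\<eta> a))"

definition cat_iso :: "('a, 'm) cat \<Rightarrow> ('b, 'n) cat \<Rightarrow> ('a, 'm, 'b, 'n) func \<Rightarrow> bool" where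
  "cat_iso A B F \<longleftrightarrow> category A \<and> category B \<and> is_functor A B F \<and>
     (\<exists>G. is_functor B A G \<and> func_eq A (func_comp G F) id_func \<and> func_eq B (func_comp F G) id_func)"


section \<open>Double categories\<close>

text \<open>
  A double category is given by four categories: \<open>HC\<close> (objects and horizontal morphisms),
  \<open>VC\<close> (objects and vertical morphisms), \<open>SH\<close> (vertical morphisms and squares, under horizontal
  composition) and \<open>SV\<close> (horizontal morphisms and squares, under vertical composition).
\<close>

record ('o, 'h, 'v, 's) dcat =
  HC :: "('o, 'h) cat"
  VC :: "('o, 'v) cat"
  SH :: "('v, 's) cat"
  SV :: "('h, 's) cat"

abbreviation "Ob C \<equiv> Obj (HC C)"
abbreviation "Ver C \<equiv> Arr (VC C)"
abbreviation "Sq C \<equiv> Arr (SH C)"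

abbreviation "lft C \<equiv> Dom (SH C)"
abbreviation "rgt C \<equiv> Cod (SH C)"
abbreviation "tp C \<equiv> Dom (SV C)"
abbreviation "bt C \<equiv> Cod (SV C)"

definition squares :: "('o, 'h, 'v, 's) dcat \<Rightarrow> 'v \<Rightarrow> 'h \<Rightarrow> 'h \<Rightarrow> 'v \<Rightarrow> 's set" where
  "squares C u f f' v =
     {\<alpha> \<in> Sq C. lft C \<alpha> = u \<and> tp C \<alpha> = f \<and> bt C \<alpha> = f' \<and> rgt C \<alpha> = v}"

locale double_category =
  fixes C :: "('o, 'h, 'v, 's) dcat"
  assumes cat_HC: "category (HC C)"
    and cat_VC: "category (VC C)"
    and cat_SH: "category (SH C)"
    and cat_SV: "category (SV C)"
    and obj_VC: "Obj (VC C) = Obj (HC C)"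
    and obj_SH: "Obj (SH C) = Arr (VC C)"
    and obj_SV: "Obj (SV C) = Arr (HC C)"
    and arr_SV: "Arr (SV C) = Arr (SH C)"
    and corner_lt: "\<And>\<alpha>. \<alpha> \<in> Sq C \<Longrightarrow> Dom (HC C) (tp C \<alpha>) = Dom (VC C) (lft C \<alpha>)"
    and corner_rt: "\<And>\<alpha>. \<alpha> \<in> Sq C \<Longrightarrow> Cod (HC C) (tp C \<alpha>) = Dom (VC C) (rgt C \<alpha>)"
    and corner_lb: "\<And>\<alpha>. \<alpha> \<in> Sq C \<Longrightarrow> Dom (HC C) (bt C \<alpha>) = Cod (VC C) (lft C \<alpha>)"
    and corner_rb: "\<And>\<alpha>. \<alpha> \<in> Sq C \<Longrightarrow> Cod (HC C) (bt C \<alpha>) = Cod (VC C) (rgt C \<alpha>)"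
    and tp_comp: "\<And>\<alpha> \<beta>. \<alpha> \<in> Sq C \<Longrightarrow> \<beta> \<in> Sq C \<Longrightarrow> rgt C \<alpha> = lft C \<beta> \<Longrightarrow>
      tp C (Comp (SH C) \<beta> \<alpha>) = Comp (HC C) (tp C \<beta>) (tp C \<alpha>)"
    and bt_comp: "\<And>\<alpha> \<beta>. \<alpha> \<in> Sq C \<Longrightarrow> \<beta> \<in> Sq C \<Longrightarrow> rgt C \<alpha> = lft C \<beta> \<Longrightarrow>
      bt C (Comp (SH C) \<beta> \<alpha>) = Comp (HC C) (bt C \<beta>) (bt C \<alpha>)"
    and lft_comp: "\<And>\<alpha> \<alpha>'. \<alpha> \<in> Sq C \<Longrightarrow> \<alpha>' \<in> Sq C \<Longrightarrow> bt C \<alpha> = tp C \<alpha>' \<Longrightarrow>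
      lft C (Comp (SV C) \<alpha>' \<alpha>) = Comp (VC C) (lft C \<alpha>') (lft C \<alpha>)"
    and rgt_comp: "\<And>\<alpha> \<alpha>'. \<alpha> \<in> Sq C \<Longrightarrow> \<alpha>' \<in> Sq C \<Longrightarrow> bt C \<alpha> = tp C \<alpha>' \<Longrightarrow>
      rgt C (Comp (SV C) \<alpha>' \<alpha>) = Comp (VC C) (rgt C \<alpha>') (rgt C \<alpha>)"
    and tp_ident: "\<And>u. u \<in> Ver C \<Longrightarrow> tp C (Ident (SH C) u) = Ident (HC C) (Dom (VC C) u)"
    and bt_ident: "\<And>u. u \<in> Ver C \<Longrightarrow> bt C (Ident (SH C) u) = Ident (HC C) (Cod (VC C) u)"
    and lft_ident: "\<And>f. f \<in> Arr (HC C) \<Longrightarrow> lft C (Ident (SV C) f) = Ident (VC C) (Dom (HC C) f)"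
    and rgt_ident: "\<And>f. f \<in> Arr (HC C) \<Longrightarrow> rgt C (Ident (SV C) f) = Ident (VC C) (Cod (HC C) f)"
    and interchange: "\<And>\<alpha> \<beta> \<alpha>' \<beta>'.
      \<alpha> \<in> Sq C \<Longrightarrow> \<beta> \<in> Sq C \<Longrightarrow> \<alpha>' \<in> Sq C \<Longrightarrow> \<beta>' \<in> Sq C \<Longrightarrow>
      rgt C \<alpha> = lft C \<beta> \<Longrightarrow> rgt C \<alpha>' = lft C \<beta>' \<Longrightarrow>
      bt C \<alpha> = tp C \<alpha>' \<Longrightarrow> bt C \<beta> = tp C \<beta>' \<Longrightarrow>
      Comp (SV C) (Comp (SH C) \<beta>' \<alpha>') (Comp (SH C) \<beta> \<alpha>) =
      Comp (SH C) (Comp (SV C) \<beta>' \<beta>) (Comp (SV C) \<alpha>' \<alpha>)"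
    and vident_comp: "\<And>f g x y z. f \<in> hom (HC C) x y \<Longrightarrow> g \<in> hom (HC C) y z \<Longrightarrow>
      Comp (SH C) (Ident (SV C) g) (Ident (SV C) f) = Ident (SV C) (Comp (HC C) g f)"
    and hident_comp: "\<And>u u' x y z. u \<in> hom (VC C) x y \<Longrightarrow> u' \<in> hom (VC C) y z \<Longrightarrow>
      Comp (SV C) (Ident (SH C) u') (Ident (SH C) u) = Ident (SH C) (Comp (VC C) u' u)"
    and ident_ident: "\<And>x. x \<in> Ob C \<Longrightarrow>
      Ident (SV C) (Ident (HC C) x) = Ident (SH C) (Ident (VC C) x)"


section \<open>Profunctors\<close>

text \<open>
  \<open>Elt U a a'\<close> is the set \<open>U(a,a')\<close>, and \<open>Act U f f'\<close> is the map \<open>U(f,f')\<close>, contravariant in \<open>f\<close>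
  and covariant in \<open>f'\<close>.
\<close>

record ('a, 'm, 'b, 'n, 'p) prof =
  Elt :: "'a \<Rightarrow> 'b \<Rightarrow> 'p set"
  Act :: "'m \<Rightarrow> 'n \<Rightarrow> 'p \<Rightarrow> 'p"

definition profunctor :: "('a, 'm) cat \<Rightarrow> ('b, 'n) cat \<Rightarrow> ('a, 'm, 'b, 'n, 'p) prof \<Rightarrow> bool" where
  "profunctor A A' U \<longleftrightarrow>
     (\<forall>a b a' b' f f' s. f \<in> hom A b a \<longrightarrow> f' \<in> hom A' a' b' \<longrightarrow> s \<in> Elt U a a' \<longrightarrow>
        Act U f f' s \<in> Elt U b b') \<and>
     (\<forall>a \<in> Obj A. \<forall>a' \<in> Obj A'. \<forall>s \<in> Elt U a a'. Act U (Ident A a) (Ident A' a') s = s) \<and>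
     (\<forall>a b c a' b' c' f g f' g' s.
        f \<in> hom A b a \<longrightarrow> g \<in> hom A c b \<longrightarrow> f' \<in> hom A' a' b' \<longrightarrow> g' \<in> hom A' b' c' \<longrightarrow>
        s \<in> Elt U a a' \<longrightarrow>
        Act U (Comp A f g) (Comp A' g' f') s = Act U g g' (Act U f f' s))"

text \<open>Natural transformations \<open>U \<Rightarrow> V(F\<^sup>o\<^sup>p \<times> F')\<close>.\<close>

definition prof_nat :: "('a, 'm) cat \<Rightarrow> ('b, 'n) cat \<Rightarrow> ('a, 'm, 'b, 'n, 'p) prof \<Rightarrow>
    ('a, 'm, 'c, 'k) func \<Rightarrow> ('b, 'n, 'd, 'l) func \<Rightarrow> ('c, 'k, 'd, 'l, 'q) prof \<Rightarrow>
    ('a \<Rightarrow> 'b \<Rightarrow> 'p \<Rightarrow> 'q) \<Rightarrow> bool" where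
  "prof_nat A A' U F F' V \<phi> \<longleftrightarrow>
     (\<forall>a \<in> Obj A. \<forall>a' \<in> Obj A'. \<forall>s \<in> Elt U a a'. \<phi> a a' s \<in> Elt V (fob F a) (fob F' a')) \<and>
     (\<forall>a b a' b' f f' s. f \<in> hom A b a \<longrightarrow> f' \<in> hom A' a' b' \<longrightarrow> s \<in> Elt U a a' \<longrightarrow>
        \<phi> b b' (Act U f f' s) = Act V (far F f) (far F' f') (\<phi> a a' s))"

text \<open>
  The coend composite: \<open>(U'\<bullet>U)(a,a'')\<close> is the quotient of the set of triples \<open>(a',s',s)\<close> with
  \<open>s' \<in> U'(a',a'')\<close> and \<open>s \<in> U(a,a')\<close> by the equivalence relation generated by
  \<open>(c, U'(k,1) t', s) \<sim> (d, t', U(1,k) s)\<close> for \<open>k : c \<rightarrow> d\<close>.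
\<close>

definition coend_pairs :: "('b, 'n) cat \<Rightarrow> ('b, 'n, 'c, 'l, 'q) prof \<Rightarrow> ('a, 'm, 'b, 'n, 'p) prof \<Rightarrow>
    'a \<Rightarrow> 'c \<Rightarrow> ('b \<times> 'q \<times> 'p) set" where
  "coend_pairs A' U' U a a'' = (SIGMA c : Obj A'. Elt U' c a'' \<times> Elt U a c)"

definition coend_step :: "('a, 'm) cat \<Rightarrow> ('b, 'n) cat \<Rightarrow> ('c, 'l) cat \<Rightarrow>
    ('b, 'n, 'c, 'l, 'q) prof \<Rightarrow> ('a, 'm, 'b, 'n, 'p) prof \<Rightarrow> 'a \<Rightarrow> 'c \<Rightarrow> ('b \<times> 'q \<times> 'p) rel" where
  "coend_step A A' A'' U' U a a'' =
     {((c, Act U' k (Ident A'' a'') t', s), (d, t', Act U (Ident A a) k s)) | c d k t' s.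
        k \<in> hom A' c d \<and> t' \<in> Elt U' d a'' \<and> s \<in> Elt U a c}"

definition coend_eq :: "('a, 'm) cat \<Rightarrow> ('b, 'n) cat \<Rightarrow> ('c, 'l) cat \<Rightarrow>
    ('b, 'n, 'c, 'l, 'q) prof \<Rightarrow> ('a, 'm, 'b, 'n, 'p) prof \<Rightarrow> 'a \<Rightarrow> 'c \<Rightarrow> ('b \<times> 'q \<times> 'p) rel" where
  "coend_eq A A' A'' U' U a a'' =
     (let r = coend_step A A' A'' U' U a a'' in (r \<union> r\<inverse>)\<^sup>*)"

text \<open>The class \<open>[s',s]\<close>, with \<open>c\<close> the middle object.\<close>

definition pclass :: "('a, 'm) cat \<Rightarrow> ('b, 'n) cat \<Rightarrow> ('c, 'l) cat \<Rightarrow>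
    ('b, 'n, 'c, 'l, 'q) prof \<Rightarrow> ('a, 'm, 'b, 'n, 'p) prof \<Rightarrow> 'a \<Rightarrow> 'c \<Rightarrow> 'b \<Rightarrow> 'q \<Rightarrow> 'p \<Rightarrow>
    ('b \<times> 'q \<times> 'p) set" where
  "pclass A A' A'' U' U a a'' c s' s = coend_eq A A' A'' U' U a a'' `` {(c, s', s)}"

text \<open>The action is \<open>[s',s] \<mapsto> [U'(1,f'') s', U(f,1) s]\<close>; the union is over all representatives.\<close>

definition pcomp :: "('a, 'm) cat \<Rightarrow> ('b, 'n) cat \<Rightarrow> ('c, 'l) cat \<Rightarrow>
    ('b, 'n, 'c, 'l, 'q) prof \<Rightarrow> ('a, 'm, 'b, 'n, 'p) prof \<Rightarrow>
    ('a, 'm, 'c, 'l, ('b \<times> 'q \<times> 'p) set) prof" where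
  "pcomp A A' A'' U' U =
     \<lparr>Elt = (\<lambda>a a''. coend_pairs A' U' U a a'' // coend_eq A A' A'' U' U a a''),
      Act = (\<lambda>f f'' S. \<Union>(c, s', s) \<in> S.
        pclass A A' A'' U' U (Dom A f) (Cod A'' f'') c
          (Act U' (Ident A' c) f'' s') (Act U f (Ident A' c) s))\<rparr>"


section \<open>Lax double presheaves\<close>

text \<open>
  Arrows of the categories \<open>Xx\<close> and elements of the profunctors \<open>Xu\<close> share the type \<open>'m\<close>, since
  normality requires \<open>Xe\<^sub>x\<close> to be the hom functor of \<open>Xx\<close>.
\<close>

record ('o, 'h, 'v, 's, 'a, 'm) presheaf =
  PCat :: "'o \<Rightarrow> ('a, 'm) cat"
  PFun :: "'h \<Rightarrow> ('a, 'm, 'a, 'm) func"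
  PPro :: "'v \<Rightarrow> ('a, 'm, 'a, 'm, 'm) prof"
  PSq :: "'s \<Rightarrow> 'a \<Rightarrow> 'a \<Rightarrow> 'm \<Rightarrow> 'm"
  PMu :: "'v \<Rightarrow> 'v \<Rightarrow> 'a \<Rightarrow> 'a \<Rightarrow> ('a \<times> 'm \<times> 'm) set \<Rightarrow> 'm"

text \<open>\<open>Xu' \<bullet> Xu\<close>, and its elements \<open>[s',s] \<in> (Xu' \<bullet> Xu)(a,a'')\<close> with middle object \<open>c\<close>.\<close>

definition pro_comp :: "('o, 'h, 'v, 's) dcat \<Rightarrow> ('o, 'h, 'v, 's, 'a, 'm) presheaf \<Rightarrow>
    'v \<Rightarrow> 'v \<Rightarrow> ('a, 'm, 'a, 'm, ('a \<times> 'm \<times> 'm) set) prof" where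
  "pro_comp C X u' u =
     pcomp (PCat X (Dom (VC C) u)) (PCat X (Cod (VC C) u)) (PCat X (Cod (VC C) u'))
       (PPro X u') (PPro X u)"

definition pro_class :: "('o, 'h, 'v, 's) dcat \<Rightarrow> ('o, 'h, 'v, 's, 'a, 'm) presheaf \<Rightarrow>
    'v \<Rightarrow> 'v \<Rightarrow> 'a \<Rightarrow> 'a \<Rightarrow> 'a \<Rightarrow> 'm \<Rightarrow> 'm \<Rightarrow> ('a \<times> 'm \<times> 'm) set" where
  "pro_class C X u' u a a'' c s' s =
     pclass (PCat X (Dom (VC C) u)) (PCat X (Cod (VC C) u)) (PCat X (Cod (VC C) u'))
       (PPro X u') (PPro X u) a a'' c s' s"

text \<open>
  In \<open>mu_ident_left\<close> and \<open>mu_ident_right\<close>, the composites of \<open>Xu\<close> with the hom functors are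
  identified with \<open>Xu\<close> by the co-Yoneda isomorphisms \<open>[s,k] \<mapsto> Xu(k,1) s\<close> and
  \<open>[k,s] \<mapsto> Xu(1,k) s\<close>.
\<close>

locale lax_double_presheaf =
  fixes C :: "('o, 'h, 'v, 's) dcat"
    and X :: "('o, 'h, 'v, 's, 'a, 'm) presheaf"
  assumes cat: "\<And>x. x \<in> Ob C \<Longrightarrow> category (PCat X x)"
    and functorial: "\<And>f x y. f \<in> hom (HC C) x y \<Longrightarrow> is_functor (PCat X y) (PCat X x) (PFun X f)"
    and prof: "\<And>u x x'. u \<in> hom (VC C) x x' \<Longrightarrow> profunctor (PCat X x) (PCat X x') (PPro X u)"
    and sq: "\<And>\<alpha> u f f' v y y'. \<alpha> \<in> squares C u f f' v \<Longrightarrow> v \<in> hom (VC C) y y' \<Longrightarrow>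
      prof_nat (PCat X y) (PCat X y') (PPro X v) (PFun X f) (PFun X f') (PPro X u) (PSq X \<alpha>)"
    and mu: "\<And>u u' x x' x''. u \<in> hom (VC C) x x' \<Longrightarrow> u' \<in> hom (VC C) x' x'' \<Longrightarrow>
      prof_nat (PCat X x) (PCat X x'') (pro_comp C X u' u) id_func id_func
        (PPro X (Comp (VC C) u' u)) (PMu X u u')"
    and fun_ident: "\<And>x. x \<in> Ob C \<Longrightarrow>
      func_eq (PCat X x) (PFun X (Ident (HC C) x)) id_func"
    and fun_comp: "\<And>f g x y z. f \<in> hom (HC C) x y \<Longrightarrow> g \<in> hom (HC C) y z \<Longrightarrow>
      func_eq (PCat X z) (PFun X (Comp (HC C) g f)) (func_comp (PFun X f) (PFun X g))"
    and sq_ident: "\<And>u x x' a a' s. u \<in> hom (VC C) x x' \<Longrightarrow>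
      a \<in> Obj (PCat X x) \<Longrightarrow> a' \<in> Obj (PCat X x') \<Longrightarrow> s \<in> Elt (PPro X u) a a' \<Longrightarrow>
      PSq X (Ident (SH C) u) a a' s = s"
    and sq_comp: "\<And>\<alpha> \<beta> u f f' v g g' w z z' a a' s.
      \<alpha> \<in> squares C u f f' v \<Longrightarrow> \<beta> \<in> squares C v g g' w \<Longrightarrow> w \<in> hom (VC C) z z' \<Longrightarrow>
      a \<in> Obj (PCat X z) \<Longrightarrow> a' \<in> Obj (PCat X z') \<Longrightarrow> s \<in> Elt (PPro X w) a a' \<Longrightarrow>
      PSq X (Comp (SH C) \<beta> \<alpha>) a a' s =
      PSq X \<alpha> (fob (PFun X g) a) (fob (PFun X g') a') (PSq X \<beta> a a' s)"
    and mu_natural: "\<And>\<alpha> \<alpha>' u f f' v u' f'' v' y y' y'' b b' b'' t t'.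
      \<alpha> \<in> squares C u f f' v \<Longrightarrow> \<alpha>' \<in> squares C u' f' f'' v' \<Longrightarrow>
      v \<in> hom (VC C) y y' \<Longrightarrow> v' \<in> hom (VC C) y' y'' \<Longrightarrow>
      b \<in> Obj (PCat X y) \<Longrightarrow> b' \<in> Obj (PCat X y') \<Longrightarrow> b'' \<in> Obj (PCat X y'') \<Longrightarrow>
      t \<in> Elt (PPro X v) b b' \<Longrightarrow> t' \<in> Elt (PPro X v') b' b'' \<Longrightarrow>
      PSq X (Comp (SV C) \<alpha>' \<alpha>) b b'' (PMu X v v' b b'' (pro_class C X v' v b b'' b' t' t)) =
      PMu X u u' (fob (PFun X f) b) (fob (PFun X f'') b'')
        (pro_class C X u' u (fob (PFun X f) b) (fob (PFun X f'') b'') (fob (PFun X f') b')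
          (PSq X \<alpha>' b' b'' t') (PSq X \<alpha> b b' t))"
    and mu_assoc: "\<And>u u' u'' x x' x'' x''' a a' a'' a''' s s' s''.
      u \<in> hom (VC C) x x' \<Longrightarrow> u' \<in> hom (VC C) x' x'' \<Longrightarrow> u'' \<in> hom (VC C) x'' x''' \<Longrightarrow>
      a \<in> Obj (PCat X x) \<Longrightarrow> a' \<in> Obj (PCat X x') \<Longrightarrow>
      a'' \<in> Obj (PCat X x'') \<Longrightarrow> a''' \<in> Obj (PCat X x''') \<Longrightarrow>
      s \<in> Elt (PPro X u) a a' \<Longrightarrow> s' \<in> Elt (PPro X u') a' a'' \<Longrightarrow> s'' \<in> Elt (PPro X u'') a'' a''' \<Longrightarrow>
      PMu X u (Comp (VC C) u'' u') a a''' (pro_class C X (Comp (VC C) u'' u') u a a''' a'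
        (PMu X u' u'' a' a''' (pro_class C X u'' u' a' a''' a'' s'' s')) s) =
      PMu X (Comp (VC C) u' u) u'' a a''' (pro_class C X u'' (Comp (VC C) u' u) a a''' a''
        s'' (PMu X u u' a a'' (pro_class C X u' u a a'' a' s' s)))"
    and normal_elt: "\<And>x a a'. x \<in> Ob C \<Longrightarrow> a \<in> Obj (PCat X x) \<Longrightarrow> a' \<in> Obj (PCat X x) \<Longrightarrow>
      Elt (PPro X (Ident (VC C) x)) a a' = hom (PCat X x) a a'"
    and normal_act: "\<And>x a b a' b' k k' s. x \<in> Ob C \<Longrightarrow>
      k \<in> hom (PCat X x) b a \<Longrightarrow> k' \<in> hom (PCat X x) a' b' \<Longrightarrow> s \<in> hom (PCat X x) a a' \<Longrightarrow>
      Act (PPro X (Ident (VC C) x)) k k' s = Comp (PCat X x) k' (Comp (PCat X x) s k)"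
    and normal_sq: "\<And>f x y b b' k. f \<in> hom (HC C) x y \<Longrightarrow> k \<in> hom (PCat X y) b b' \<Longrightarrow>
      PSq X (Ident (SV C) f) b b' k = far (PFun X f) k"
    and mu_ident_left: "\<And>u x x' a b a' k s. u \<in> hom (VC C) x x' \<Longrightarrow>
      k \<in> hom (PCat X x) b a \<Longrightarrow> a' \<in> Obj (PCat X x') \<Longrightarrow> s \<in> Elt (PPro X u) a a' \<Longrightarrow>
      PMu X (Ident (VC C) x) u b a' (pro_class C X u (Ident (VC C) x) b a' a s k) =
      Act (PPro X u) k (Ident (PCat X x') a') s"
    and mu_ident_right: "\<And>u x x' a a' b' k s. u \<in> hom (VC C) x x' \<Longrightarrow>
      a \<in> Obj (PCat X x) \<Longrightarrow> k \<in> hom (PCat X x') a' b' \<Longrightarrow> s \<in> Elt (PPro X u) a a' \<Longrightarrow>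
      PMu X u (Ident (VC C) x') a b' (pro_class C X (Ident (VC C) x') u a b' a' k s) =
      Act (PPro X u) (Ident (PCat X x) a) k s"

text \<open>The component \<open>(X\<eta>)\<^sub>a\<^sub>,\<^sub>a(1\<^sub>a)\<close> of \<open>X\<eta>\<close> for a globular \<open>\<eta>\<close> with right boundary \<open>e\<^sub>y\<close>.\<close>

definition glob_cmp :: "('o, 'h, 'v, 's, 'a, 'm) presheaf \<Rightarrow> 'o \<Rightarrow> 's \<Rightarrow> 'a \<Rightarrow> 'm" where
  "glob_cmp X y \<eta> a = PSq X \<eta> a a (Ident (PCat X y) a)"


section \<open>Horizontal transformations and globular modifications\<close>

text \<open>
  Transformations and modifications are extensional (\<open>undefined\<close> off their carriers), so that HOL
  equality is equality of transformations and of modifications.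
\<close>

record ('o, 'v, 'a, 'm, 'b, 'n) htrans =
  TFun :: "'o \<Rightarrow> ('a, 'm, 'b, 'n) func"
  TPro :: "'v \<Rightarrow> 'a \<Rightarrow> 'a \<Rightarrow> 'm \<Rightarrow> 'n"

definition mk_htrans :: "('o, 'h, 'v, 's) dcat \<Rightarrow> ('o, 'h, 'v, 's, 'a, 'm) presheaf \<Rightarrow>
    ('o \<Rightarrow> ('a, 'm, 'b, 'n) func) \<Rightarrow> ('v \<Rightarrow> 'a \<Rightarrow> 'a \<Rightarrow> 'm \<Rightarrow> 'n) \<Rightarrow>
    ('o, 'v, 'a, 'm, 'b, 'n) htrans" where
  "mk_htrans C X T P =
     \<lparr>TFun = (\<lambda>x \<in> Ob C. func_restrict (PCat X x) (T x)),
      TPro = (\<lambda>u \<in> Ver C. \<lambda>a \<in> Obj (PCat X (Dom (VC C) u)). \<lambda>a' \<in> Obj (PCat X (Cod (VC C) u)).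
        restrict (P u a a') (Elt (PPro X u) a a'))\<rparr>"

definition htrans_extensional :: "('o, 'h, 'v, 's) dcat \<Rightarrow> ('o, 'h, 'v, 's, 'a, 'm) presheaf \<Rightarrow>
    ('o, 'v, 'a, 'm, 'b, 'n) htrans \<Rightarrow> bool" where
  "htrans_extensional C X F \<longleftrightarrow>
     TFun F \<in> extensional (Ob C) \<and>
     (\<forall>x \<in> Ob C. func_extensional (PCat X x) (TFun F x)) \<and>
     TPro F \<in> extensional (Ver C) \<and>
     (\<forall>u x x'. u \<in> hom (VC C) x x' \<longrightarrow>
        TPro F u \<in> extensional (Obj (PCat X x)) \<and>
        (\<forall>a \<in> Obj (PCat X x). TPro F u a \<in> extensional (Obj (PCat X x')) \<and>
          (\<forall>a' \<in> Obj (PCat X x'). TPro F u a a' \<in> extensional (Elt (PPro X u) a a'))))"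

locale horizontal_transformation =
  fixes C :: "('o, 'h, 'v, 's) dcat"
    and X :: "('o, 'h, 'v, 's, 'a, 'm) presheaf"
    and Y :: "('o, 'h, 'v, 's, 'b, 'n) presheaf"
    and F :: "('o, 'v, 'a, 'm, 'b, 'n) htrans"
  assumes ext: "htrans_extensional C X F"
    and functorial: "\<And>x. x \<in> Ob C \<Longrightarrow> is_functor (PCat X x) (PCat Y x) (TFun F x)"
    and pro: "\<And>u x x'. u \<in> hom (VC C) x x' \<Longrightarrow>
      prof_nat (PCat X x) (PCat X x') (PPro X u) (TFun F x) (TFun F x') (PPro Y u) (TPro F u)"
    and natural_hor: "\<And>f x y. f \<in> hom (HC C) x y \<Longrightarrow>
      func_eq (PCat X y) (func_comp (TFun F x) (PFun X f)) (func_comp (PFun Y f) (TFun F y))"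
    and natural_sq: "\<And>\<alpha> u f f' v y y' b b' s.
      \<alpha> \<in> squares C u f f' v \<Longrightarrow> v \<in> hom (VC C) y y' \<Longrightarrow>
      b \<in> Obj (PCat X y) \<Longrightarrow> b' \<in> Obj (PCat X y') \<Longrightarrow> s \<in> Elt (PPro X v) b b' \<Longrightarrow>
      TPro F u (fob (PFun X f) b) (fob (PFun X f') b') (PSq X \<alpha> b b' s) =
      PSq Y \<alpha> (fob (TFun F y) b) (fob (TFun F y') b') (TPro F v b b' s)"
    and compat_mu: "\<And>u u' x x' x'' a a' a'' s s'.
      u \<in> hom (VC C) x x' \<Longrightarrow> u' \<in> hom (VC C) x' x'' \<Longrightarrow>
      a \<in> Obj (PCat X x) \<Longrightarrow> a' \<in> Obj (PCat X x') \<Longrightarrow> a'' \<in> Obj (PCat X x'') \<Longrightarrow>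
      s \<in> Elt (PPro X u) a a' \<Longrightarrow> s' \<in> Elt (PPro X u') a' a'' \<Longrightarrow>
      TPro F (Comp (VC C) u' u) a a'' (PMu X u u' a a'' (pro_class C X u' u a a'' a' s' s)) =
      PMu Y u u' (fob (TFun F x) a) (fob (TFun F x'') a'')
        (pro_class C Y u' u (fob (TFun F x) a) (fob (TFun F x'') a'') (fob (TFun F x') a')
          (TPro F u' a' a'' s') (TPro F u a a' s))"
    and normal: "\<And>x a a' k. x \<in> Ob C \<Longrightarrow> k \<in> hom (PCat X x) a a' \<Longrightarrow>
      TPro F (Ident (VC C) x) a a' k = far (TFun F x) k"

record ('o, 'v, 'a, 'm, 'b, 'n) modif =
  MSrc :: "('o, 'v, 'a, 'm, 'b, 'n) htrans"
  MTgt :: "('o, 'v, 'a, 'm, 'b, 'n) htrans"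
  MCmp :: "'o \<Rightarrow> 'a \<Rightarrow> 'n"

definition mk_modif :: "('o, 'h, 'v, 's) dcat \<Rightarrow> ('o, 'h, 'v, 's, 'a, 'm) presheaf \<Rightarrow>
    ('o, 'v, 'a, 'm, 'b, 'n) htrans \<Rightarrow> ('o, 'v, 'a, 'm, 'b, 'n) htrans \<Rightarrow> ('o \<Rightarrow> 'a \<Rightarrow> 'n) \<Rightarrow>
    ('o, 'v, 'a, 'm, 'b, 'n) modif" where
  "mk_modif C X F F' K =
     \<lparr>MSrc = F, MTgt = F', MCmp = (\<lambda>x \<in> Ob C. restrict (K x) (Obj (PCat X x)))\<rparr>"

locale globular_modification =
  fixes C :: "('o, 'h, 'v, 's) dcat"
    and X :: "('o, 'h, 'v, 's, 'a, 'm) presheaf"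
    and Y :: "('o, 'h, 'v, 's, 'b, 'n) presheaf"
    and M :: "('o, 'v, 'a, 'm, 'b, 'n) modif"
  assumes src: "horizontal_transformation C X Y (MSrc M)"
    and tgt: "horizontal_transformation C X Y (MTgt M)"
    and ext: "MCmp M \<in> extensional (Ob C)"
    and ext_cmp: "\<And>x. x \<in> Ob C \<Longrightarrow> MCmp M x \<in> extensional (Obj (PCat X x))"
    and natural: "\<And>x. x \<in> Ob C \<Longrightarrow>
      nat_trans (PCat X x) (PCat Y x) (TFun (MSrc M) x) (TFun (MTgt M) x) (MCmp M x)"
    and compat_hor: "\<And>f x y b. f \<in> hom (HC C) x y \<Longrightarrow> b \<in> Obj (PCat X y) \<Longrightarrow>
      far (PFun Y f) (MCmp M y b) = MCmp M x (fob (PFun X f) b)"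
    and compat_ver: "\<And>u x x' a a' s. u \<in> hom (VC C) x x' \<Longrightarrow>
      a \<in> Obj (PCat X x) \<Longrightarrow> a' \<in> Obj (PCat X x') \<Longrightarrow> s \<in> Elt (PPro X u) a a' \<Longrightarrow>
      Act (PPro Y u) (Ident (PCat Y x) (fob (TFun (MSrc M) x) a)) (MCmp M x' a')
        (TPro (MSrc M) u a a' s) =
      Act (PPro Y u) (MCmp M x a) (Ident (PCat Y x') (fob (TFun (MTgt M) x') a'))
        (TPro (MTgt M) u a a' s)"


section \<open>The 2-category of lax double presheaves\<close>

text \<open>
  The source and the target of a transformation may be presheaves over different value types; in
  particular representables need not have the same value types as other presheaves.
\<close>

definition modif_id :: "('o, 'h, 'v, 's) dcat \<Rightarrow> ('o, 'h, 'v, 's, 'a, 'm) presheaf \<Rightarrow>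
    ('o, 'h, 'v, 's, 'b, 'n) presheaf \<Rightarrow> ('o, 'v, 'a, 'm, 'b, 'n) htrans \<Rightarrow>
    ('o, 'v, 'a, 'm, 'b, 'n) modif" where
  "modif_id C X Y F = mk_modif C X F F (\<lambda>x a. Ident (PCat Y x) (fob (TFun F x) a))"

definition modif_vcomp :: "('o, 'h, 'v, 's) dcat \<Rightarrow> ('o, 'h, 'v, 's, 'a, 'm) presheaf \<Rightarrow>
    ('o, 'h, 'v, 's, 'b, 'n) presheaf \<Rightarrow> ('o, 'v, 'a, 'm, 'b, 'n) modif \<Rightarrow>
    ('o, 'v, 'a, 'm, 'b, 'n) modif \<Rightarrow> ('o, 'v, 'a, 'm, 'b, 'n) modif" where
  "modif_vcomp C X Y N M =
     mk_modif C X (MSrc M) (MTgt N) (\<lambda>x a. Comp (PCat Y x) (MCmp N x a) (MCmp M x a))"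

definition psh_hom :: "('o, 'h, 'v, 's) dcat \<Rightarrow> ('o, 'h, 'v, 's, 'a, 'm) presheaf \<Rightarrow>
    ('o, 'h, 'v, 's, 'b, 'n) presheaf \<Rightarrow>
    (('o, 'v, 'a, 'm, 'b, 'n) htrans, ('o, 'v, 'a, 'm, 'b, 'n) modif) cat" where
  "psh_hom C X Y =
     \<lparr>Obj = {F. horizontal_transformation C X Y F},
      Arr = {M. globular_modification C X Y M},
      Dom = MSrc, Cod = MTgt, Ident = modif_id C X Y, Comp = modif_vcomp C X Y\<rparr>"

definition htrans_comp :: "('o, 'h, 'v, 's) dcat \<Rightarrow> ('o, 'h, 'v, 's, 'a, 'm) presheaf \<Rightarrow>
    ('o, 'v, 'b, 'n, 'c, 'l) htrans \<Rightarrow> ('o, 'v, 'a, 'm, 'b, 'n) htrans \<Rightarrow>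
    ('o, 'v, 'a, 'm, 'c, 'l) htrans" where
  "htrans_comp C X G F =
     mk_htrans C X (\<lambda>x. func_comp (TFun G x) (TFun F x))
       (\<lambda>u a a' s. TPro G u (fob (TFun F (Dom (VC C) u)) a) (fob (TFun F (Cod (VC C) u)) a')
          (TPro F u a a' s))"

text \<open>
  The horizontal composite \<open>N * M\<close> of \<open>M : F \<Rightarrow> F' : X \<Rightarrow> Y\<close> and \<open>N : G \<Rightarrow> G' : Y \<Rightarrow> Z\<close> has the
  components \<open>N\<^sub>F\<^sub>'\<^sub>a \<circ> G(M\<^sub>a)\<close>.
\<close>

definition modif_hcomp :: "('o, 'h, 'v, 's) dcat \<Rightarrow> ('o, 'h, 'v, 's, 'a, 'm) presheaf \<Rightarrow>
    ('o, 'h, 'v, 's, 'c, 'l) presheaf \<Rightarrow> ('o, 'v, 'b, 'n, 'c, 'l) modif \<Rightarrow>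
    ('o, 'v, 'a, 'm, 'b, 'n) modif \<Rightarrow> ('o, 'v, 'a, 'm, 'c, 'l) modif" where
  "modif_hcomp C X Z N M =
     mk_modif C X (htrans_comp C X (MSrc N) (MSrc M)) (htrans_comp C X (MTgt N) (MTgt M))
       (\<lambda>x a. Comp (PCat Z x) (MCmp N x (fob (TFun (MTgt M) x) a)) (far (TFun (MSrc N) x) (MCmp M x a)))"


section \<open>Representables\<close>

definition rep_cat :: "('o, 'h, 'v, 's) dcat \<Rightarrow> 'o \<Rightarrow> 'o \<Rightarrow> ('h, 's) cat" where
  "rep_cat C xh x =
     \<lparr>Obj = hom (HC C) x xh,
      Arr = {\<eta> \<in> Sq C. lft C \<eta> = Ident (VC C) x \<and> rgt C \<eta> = Ident (VC C) xh},
      Dom = tp C, Cod = bt C, Ident = Ident (SV C), Comp = Comp (SV C)\<rparr>"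

definition rep :: "('o, 'h, 'v, 's) dcat \<Rightarrow> 'o \<Rightarrow> ('o, 'h, 'v, 's, 'h, 's) presheaf" where
  "rep C xh =
     \<lparr>PCat = rep_cat C xh,
      PFun = (\<lambda>f. \<lparr>fob = (\<lambda>g. Comp (HC C) g f), far = (\<lambda>\<eta>. Comp (SH C) \<eta> (Ident (SV C) f))\<rparr>),
      PPro = (\<lambda>u. \<lparr>Elt = (\<lambda>g g'. squares C u g g' (Ident (VC C) xh)),
                   Act = (\<lambda>\<eta> \<eta>' \<alpha>. Comp (SV C) \<eta>' (Comp (SV C) \<alpha> \<eta>))\<rparr>),
      PSq = (\<lambda>\<alpha> g g' \<eta>. Comp (SH C) \<eta> \<alpha>),
      PMu = (\<lambda>u u' g g'' S. the_elem ((\<lambda>(c, \<alpha>', \<alpha>). Comp (SV C) \<alpha>' \<alpha>) ` S))\<rparr>"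

definition rep_htrans :: "('o, 'h, 'v, 's) dcat \<Rightarrow> 'h \<Rightarrow> ('o, 'v, 'h, 's, 'h, 's) htrans" where
  "rep_htrans C fh =
     mk_htrans C (rep C (Dom (HC C) fh))
       (\<lambda>x. \<lparr>fob = (\<lambda>g. Comp (HC C) fh g), far = (\<lambda>\<eta>. Comp (SH C) (Ident (SV C) fh) \<eta>)\<rparr>)
       (\<lambda>u g g' \<alpha>. Comp (SH C) (Ident (SV C) fh) \<alpha>)"

definition rep_modif :: "('o, 'h, 'v, 's) dcat \<Rightarrow> 's \<Rightarrow> ('o, 'v, 'h, 's, 'h, 's) modif" where
  "rep_modif C ah =
     mk_modif C (rep C (Dom (HC C) (tp C ah)))
       (rep_htrans C (tp C ah)) (rep_htrans C (bt C ah))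
       (\<lambda>x g. Comp (SH C) ah (Ident (SV C) g))"


section \<open>2-naturality\<close>

text \<open>
  \<open>\<Phi> xh X\<close> is a candidate for the component \<open>P(C(-,xh),X) \<rightarrow> X(xh)\<close>. The functors \<open>pre_hom\<close> and
  \<open>post_hom\<close> are the actions of a horizontal morphism \<open>fh : xh \<rightarrow> yh\<close> and of a horizontal
  transformation \<open>F : X \<Rightarrow> Y\<close> on the hom categories; a 2-cell acts on \<open>G\<close> by whiskering with \<open>G\<close>.
\<close>

definition pre_hom :: "('o, 'h, 'v, 's) dcat \<Rightarrow> ('o, 'h, 'v, 's, 'a, 'm) presheaf \<Rightarrow> 'h \<Rightarrow>
    (('o, 'v, 'h, 's, 'a, 'm) htrans, ('o, 'v, 'h, 's, 'a, 'm) modif,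
     ('o, 'v, 'h, 's, 'a, 'm) htrans, ('o, 'v, 'h, 's, 'a, 'm) modif) func" where
  "pre_hom C X fh =
     (let R = rep C (Dom (HC C) fh); S = rep C (Cod (HC C) fh); h = rep_htrans C fh in
      \<lparr>fob = (\<lambda>G. htrans_comp C R G h),
       far = (\<lambda>M. modif_hcomp C R X M (modif_id C R S h))\<rparr>)"

definition post_hom :: "('o, 'h, 'v, 's) dcat \<Rightarrow> 'o \<Rightarrow> ('o, 'h, 'v, 's, 'a, 'm) presheaf \<Rightarrow>
    ('o, 'h, 'v, 's, 'b, 'n) presheaf \<Rightarrow> ('o, 'v, 'a, 'm, 'b, 'n) htrans \<Rightarrow>
    (('o, 'v, 'h, 's, 'a, 'm) htrans, ('o, 'v, 'h, 's, 'a, 'm) modif,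
     ('o, 'v, 'h, 's, 'b, 'n) htrans, ('o, 'v, 'h, 's, 'b, 'n) modif) func" where
  "post_hom C xh X Y F =
     \<lparr>fob = (\<lambda>G. htrans_comp C (rep C xh) F G),
      far = (\<lambda>M. modif_hcomp C (rep C xh) Y (modif_id C X Y F) M)\<rparr>"

type_synonym ('o, 'h, 'v, 's, 'a, 'm) yoneda_family =
  "'o \<Rightarrow> ('o, 'h, 'v, 's, 'a, 'm) presheaf \<Rightarrow>
    (('o, 'v, 'h, 's, 'a, 'm) htrans, ('o, 'v, 'h, 's, 'a, 'm) modif, 'a, 'm) func"

definition two_natural_in_object :: "('o, 'h, 'v, 's) dcat \<Rightarrow>
    ('o, 'h, 'v, 's, 'a, 'm) yoneda_family \<Rightarrow> bool" where
  "two_natural_in_object C \<Phi> \<longleftrightarrow>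
     (\<forall>X xh yh. lax_double_presheaf C X \<longrightarrow>
       (\<forall>fh \<in> hom (HC C) xh yh.
          func_eq (psh_hom C (rep C yh) X)
            (func_comp (\<Phi> xh X) (pre_hom C X fh)) (func_comp (PFun X fh) (\<Phi> yh X))) \<and>
       (\<forall>fh \<in> hom (HC C) xh yh. \<forall>fh' \<in> hom (HC C) xh yh.
        \<forall>ah \<in> squares C (Ident (VC C) xh) fh fh' (Ident (VC C) yh).
        \<forall>G \<in> Obj (psh_hom C (rep C yh) X).
          far (\<Phi> xh X) (modif_hcomp C (rep C xh) X (modif_id C (rep C yh) X G) (rep_modif C ah)) =
          glob_cmp X yh ah (fob (\<Phi> yh X) G)))"

definition two_natural_in_presheaf :: "('o, 'h, 'v, 's) dcat \<Rightarrow>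
    ('o, 'h, 'v, 's, 'a, 'm) yoneda_family \<Rightarrow> bool" where
  "two_natural_in_presheaf C \<Phi> \<longleftrightarrow>
     (\<forall>X Y. \<forall>xh \<in> Ob C. lax_double_presheaf C X \<longrightarrow> lax_double_presheaf C Y \<longrightarrow>
       (\<forall>F \<in> Obj (psh_hom C X Y).
          func_eq (psh_hom C (rep C xh) X)
            (func_comp (\<Phi> xh Y) (post_hom C xh X Y F)) (func_comp (TFun F xh) (\<Phi> xh X))) \<and>
       (\<forall>M \<in> Arr (psh_hom C X Y). \<forall>G \<in> Obj (psh_hom C (rep C xh) X).
          far (\<Phi> xh Y) (modif_hcomp C (rep C xh) Y M (modif_id C (rep C xh) X G)) =
          MCmp M xh (fob (\<Phi> xh X) G)))"

end

theory Submission
  imports Defs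
begin

text \<open>
  The isomorphism evaluates at the identity: it sends \<open>F\<close> to \<open>F\<^sub>x\<^sub>h(1\<^sub>x\<^sub>h)\<close> and \<open>A\<close> to
  \<open>A\<^sub>x\<^sub>h(1\<^sub>x\<^sub>h)\<close>, where \<open>xh\<close> is the representing object.

  A horizontal morphism \<open>g : x \<rightarrow> xh\<close> is the restriction of \<open>1\<^sub>x\<^sub>h\<close> along \<open>g\<close>, and a square
  \<open>\<alpha>\<close> with right boundary \<open>e\<^sub>x\<^sub>h\<close> is the restriction along \<open>\<alpha>\<close> of the identity square on
  \<open>e\<^sub>x\<^sub>h\<close>. Compatibility with the horizontal structure therefore forces
  \<open>F\<^sub>x(g) = (Xg)(a)\<close> and \<open>F\<^sub>u(\<alpha>) = (X\<alpha>)\<^sub>a\<^sub>,\<^sub>a(1\<^sub>a)\<close> with \<open>a = F\<^sub>x\<^sub>h(1\<^sub>x\<^sub>h)\<close>, and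
  \<open>A\<^sub>x(g) = (Xg)(k)\<close> with \<open>k = A\<^sub>x\<^sub>h(1\<^sub>x\<^sub>h)\<close>. These are \<open>transformation_determined\<close> and
  \<open>modification_determined\<close>.

  Conversely the same formulas define, for every object \<open>a\<close> and arrow \<open>k\<close> of \<open>X(xh)\<close>, a
  transformation \<open>yoneda_htrans\<close> and a modification \<open>yoneda_modif\<close>. Here the vertical structure
  enters, and everything rests on two facts about the value \<open>(X\<alpha>)\<^sub>a\<^sub>,\<^sub>a(1\<^sub>a)\<close> of a square.
  By naturality of \<open>\<mu>\<close> and normality, the value of a vertical composite is \<open>\<mu>\<close> applied to the
  class of the two values (\<open>value_vcomp\<close>); this gives functoriality, naturality in the two
  arguments of the profunctors and compatibility with \<open>\<mu>\<close>. By naturality of \<open>X\<alpha>\<close>, an arrow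
  \<open>k : a \<rightarrow> b\<close> can be moved from the target side of the value at \<open>a\<close> to the source side of the
  value at \<open>b\<close> (\<open>value_slide\<close>); this is exactly the vertical compatibility of the modification.

  2-naturality needs no further idea, as evaluating at an identity morphism turns each of the four
  equations into one of the above formulas for \<open>F\<close> and \<open>A\<close>, up to identities in the horizontal
  composites of modifications.
\<close>

section \<open>Categories, functors and squares\<close>

lemma (in category) hom_objects:
  assumes "f \<in> hom A a b"
  shows "a \<in> Obj A" "b \<in> Obj A"
  using assms dom_obj[of f] cod_obj[of f] by (auto simp: hom_def)

lemma is_functorD:
  assumes "is_functor A B F"
  shows "a \<in> Obj A \<Longrightarrow> fob F a \<in> Obj B"
    and "a \<in> Obj A \<Longrightarrow> far F (Ident A a) = Ident B (fob F a)"
    and "f \<in> hom A a b \<Longrightarrow> g \<in> hom A b c \<Longrightarrow> far F (Comp A g f) = Comp B (far F g) (far F f)"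
  using assms unfolding is_functor_def by blast+

lemma is_functor_hom:
  assumes "is_functor A B F" "category A" "f \<in> hom A a b"
  shows "far F f \<in> hom B (fob F a) (fob F b)"
  using assms category.hom_objects[OF assms(2,3)] unfolding is_functor_def by blast

lemma profunctorD:
  assumes "profunctor A A' U"
  shows "f \<in> hom A b a \<Longrightarrow> f' \<in> hom A' a' b' \<Longrightarrow> s \<in> Elt U a a' \<Longrightarrow> Act U f f' s \<in> Elt U b b'"
    and "f \<in> hom A b a \<Longrightarrow> g \<in> hom A c b \<Longrightarrow> f' \<in> hom A' a' b' \<Longrightarrow> g' \<in> hom A' b' c' \<Longrightarrow>
      s \<in> Elt U a a' \<Longrightarrow> Act U (Comp A f g) (Comp A' g' f') s = Act U g g' (Act U f f' s)"
    and "a \<in> Obj A \<Longrightarrow> a' \<in> Obj A' \<Longrightarrow> s \<in> Elt U a a' \<Longrightarrow>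
      Act U (Ident A a) (Ident A' a') s = s"
  using assms unfolding profunctor_def by meson+

lemma prof_natD:
  assumes "prof_nat A A' U F F' V \<phi>"
  shows "a \<in> Obj A \<Longrightarrow> a' \<in> Obj A' \<Longrightarrow> s \<in> Elt U a a' \<Longrightarrow>
      \<phi> a a' s \<in> Elt V (fob F a) (fob F' a')"
    and "f \<in> hom A b a \<Longrightarrow> f' \<in> hom A' a' b' \<Longrightarrow> s \<in> Elt U a a' \<Longrightarrow>
      \<phi> b b' (Act U f f' s) = Act V (far F f) (far F' f') (\<phi> a a' s)"
  using assms unfolding prof_nat_def by meson+

lemma nat_transD:
  assumes "nat_trans A B F G \<eta>"
  shows "a \<in> Obj A \<Longrightarrow> \<eta> a \<in> hom B (fob F a) (fob G a)"
    and "f \<in> hom A a b \<Longrightarrow> Comp B (\<eta> b) (far F f) = Comp B (far G f) (\<eta> a)"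
  using assms unfolding nat_trans_def by meson+

text \<open>
  Functoriality in two variables: \<open>(f, f')\<close> factors through \<open>(f, 1)\<close> and \<open>(1, f')\<close> in either
  order. Exchanging the order is what makes modifications compose.
\<close>

lemma profunctor_act_split:
  assumes "profunctor A A' U" "category A" "category A'"
    and f: "f \<in> hom A b a" and f': "f' \<in> hom A' a' b'" and s: "s \<in> Elt U a a'"
  shows "Act U (Ident A b) f' (Act U f (Ident A' a') s) = Act U f f' s"
    and "Act U f (Ident A' b') (Act U (Ident A a) f' s) = Act U f f' s"
proof -
  interpret A: category A by fact
  interpret A': category A' by fact
  note ob = A.hom_objects[OF f] A'.hom_objects[OF f']
  show "Act U (Ident A b) f' (Act U f (Ident A' a') s) = Act U f f' s"
    using profunctorD(2)[OF assms(1) f A.ident_hom[OF ob(1)] A'.ident_hom[OF ob(3)] f' s]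
    by (simp add: A.ident_right[OF f] A'.ident_right[OF f'])
  show "Act U f (Ident A' b') (Act U (Ident A a) f' s) = Act U f f' s"
    using profunctorD(2)[OF assms(1) A.ident_hom[OF ob(2)] f f' A'.ident_hom[OF ob(4)] s]
    by (simp add: A.ident_left[OF f] A'.ident_left[OF f'])
qed

context double_category
begin

interpretation HC: category "HC C" by (rule cat_HC)
interpretation VC: category "VC C" by (rule cat_VC)
interpretation SH: category "SH C" by (rule cat_SH)
interpretation SV: category "SV C" by (rule cat_SV)

lemma ver_ident: "x \<in> Ob C \<Longrightarrow> Ident (VC C) x \<in> hom (VC C) x x"
  using VC.ident_hom by (simp add: obj_VC)

lemma ver_ident_comp: "x \<in> Ob C \<Longrightarrow> Comp (VC C) (Ident (VC C) x) (Ident (VC C) x) = Ident (VC C) x"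
  using ver_ident VC.ident_left by blast

lemma ver_objects: "u \<in> hom (VC C) x x' \<Longrightarrow> x \<in> Ob C" "u \<in> hom (VC C) x x' \<Longrightarrow> x' \<in> Ob C"
  using VC.hom_objects by (auto simp: obj_VC)

text \<open>
  The corner conditions recover the types of the horizontal boundaries from those of the vertical
  ones; so membership in \<open>squares\<close> is all that has to be carried around.
\<close>

lemma squares_boundary:
  assumes "\<alpha> \<in> squares C u f f' v" "u \<in> hom (VC C) x x'" "v \<in> hom (VC C) y y'"
  shows "f \<in> hom (HC C) x y" "f' \<in> hom (HC C) x' y'"
proof -
  have a: "\<alpha> \<in> Arr (SV C)" using assms(1) by (simp add: squares_def arr_SV)
  show "f \<in> hom (HC C) x y" "f' \<in> hom (HC C) x' y'"
    using SV.dom_obj[OF a] SV.cod_obj[OF a] assms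
      corner_lt[of \<alpha>] corner_rt[of \<alpha>] corner_lb[of \<alpha>] corner_rb[of \<alpha>]
    by (auto simp: hom_def squares_def obj_SV)
qed

lemma hcomp_squares:
  assumes "\<alpha> \<in> squares C u f f' v" "\<beta> \<in> squares C v g g' w"
  shows "Comp (SH C) \<beta> \<alpha> \<in> squares C u (Comp (HC C) g f) (Comp (HC C) g' f') w"
  using assms SH.comp_hom[of \<alpha> u v \<beta> w] tp_comp[of \<alpha> \<beta>] bt_comp[of \<alpha> \<beta>]
  by (auto simp: squares_def hom_def)

lemma vcomp_squares:
  assumes "\<alpha> \<in> squares C u f f' v" "\<alpha>' \<in> squares C u' f' f'' v'"
  shows "Comp (SV C) \<alpha>' \<alpha> \<in> squares C (Comp (VC C) u' u) f f'' (Comp (VC C) v' v)"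
  using assms SV.comp_hom[of \<alpha> f f' \<alpha>' f''] lft_comp[of \<alpha> \<alpha>'] rgt_comp[of \<alpha> \<alpha>']
  by (auto simp: squares_def hom_def arr_SV)

lemma vcomp_assoc:
  assumes "\<alpha> \<in> squares C u f f' v" "\<alpha>' \<in> squares C u' f' f'' v'"
    "\<alpha>'' \<in> squares C u'' f'' f''' v''"
  shows "Comp (SV C) \<alpha>'' (Comp (SV C) \<alpha>' \<alpha>) = Comp (SV C) (Comp (SV C) \<alpha>'' \<alpha>') \<alpha>"
  using assms SV.comp_assoc[of \<alpha> f f' \<alpha>' f'' \<alpha>'' f''']
  by (auto simp: squares_def hom_def arr_SV)

lemma vcomp_ident:
  assumes "\<alpha> \<in> squares C u f f' v"
  shows "Comp (SV C) (Ident (SV C) f') \<alpha> = \<alpha>" "Comp (SV C) \<alpha> (Ident (SV C) f) = \<alpha>"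
  using assms SV.ident_left[of \<alpha> f f'] SV.ident_right[of \<alpha> f f']
  by (auto simp: squares_def hom_def arr_SV)

lemma hcomp_ident:
  assumes "\<alpha> \<in> squares C u f f' v"
  shows "Comp (SH C) (Ident (SH C) v) \<alpha> = \<alpha>" "Comp (SH C) \<alpha> (Ident (SH C) u) = \<alpha>"
  using assms SH.ident_left[of \<alpha> u v] SH.ident_right[of \<alpha> u v]
  by (auto simp: squares_def hom_def)

lemma vident_squares:
  assumes "f \<in> hom (HC C) x y"
  shows "Ident (SV C) f \<in> squares C (Ident (VC C) x) f f (Ident (VC C) y)"
  using assms SV.ident_hom[of f] lft_ident[of f] rgt_ident[of f]
  by (auto simp: squares_def hom_def arr_SV obj_SV)


section \<open>Representables\<close>

lemma rep_sel [simp]: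
  "PCat (rep C xh) = rep_cat C xh"
  "fob (PFun (rep C xh) f) g = Comp (HC C) g f"
  "far (PFun (rep C xh) f) \<eta> = Comp (SH C) \<eta> (Ident (SV C) f)"
  "Elt (PPro (rep C xh) u) g g' = squares C u g g' (Ident (VC C) xh)"
  "Act (PPro (rep C xh) u) \<eta> \<eta>' \<alpha> = Comp (SV C) \<eta>' (Comp (SV C) \<alpha> \<eta>)"
  "PSq (rep C xh) \<alpha> g g' \<eta> = Comp (SH C) \<eta> \<alpha>"
  by (simp_all add: rep_def)

lemma rep_cat_sel [simp]:
  "Obj (rep_cat C xh x) = hom (HC C) x xh"
  "Ident (rep_cat C xh x) = Ident (SV C)"
  "Comp (rep_cat C xh x) = Comp (SV C)"
  by (simp_all add: rep_cat_def)

lemma rep_cat_hom [simp]: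
  "hom (rep_cat C xh x) g g' = squares C (Ident (VC C) x) g g' (Ident (VC C) xh)"
  by (auto simp: rep_cat_def hom_def squares_def)

lemma rep_cat_arr: "\<eta> \<in> Arr (rep_cat C xh x) \<Longrightarrow>
    \<eta> \<in> squares C (Ident (VC C) x) (tp C \<eta>) (bt C \<eta>) (Ident (VC C) xh)"
  by (auto simp: rep_cat_def squares_def)

lemma category_rep_cat:
  assumes x: "x \<in> Ob C" and xh: "xh \<in> Ob C"
  shows "category (rep_cat C xh x)"
proof (unfold_locales, goal_cases)
  case (1 f)
  then show ?case
    using squares_boundary[OF rep_cat_arr[OF 1] ver_ident[OF x] ver_ident[OF xh]]
    by (simp add: rep_cat_def)
next
  case (2 f)
  then show ?case
    using squares_boundary[OF rep_cat_arr[OF 2] ver_ident[OF x] ver_ident[OF xh]]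
    by (simp add: rep_cat_def)
next
  case (3 a)
  then show ?case using vident_squares by simp
next
  case (4 f g a b c)
  then show ?case
    using vcomp_squares[of f _ a b _ g _ c] x xh by (fastforce simp: ver_ident_comp)
next
  case (5 f a b)
  then show ?case using vcomp_ident by simp
next
  case (6 f a b)
  then show ?case using vcomp_ident by simp
next
  case (7 f g h a b c d)
  then show ?case using vcomp_assoc by simp
qed

lemma rep_functor:
  assumes f: "f \<in> hom (HC C) x y" and xh: "xh \<in> Ob C"
  shows "is_functor (PCat (rep C xh) y) (PCat (rep C xh) x) (PFun (rep C xh) f)"
proof -
  let ?e = "Ident (SV C) f"
  have e: "?e \<in> squares C (Ident (VC C) x) f f (Ident (VC C) y)"
    by (rule vident_squares[OF f])
  have "Comp (SH C) (Comp (SV C) \<beta> \<alpha>) ?e = Comp (SV C) (Comp (SH C) \<beta> ?e) (Comp (SH C) \<alpha> ?e)"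
    if "\<alpha> \<in> squares C (Ident (VC C) y) g g' (Ident (VC C) xh)"
      "\<beta> \<in> squares C (Ident (VC C) y) g' g'' (Ident (VC C) xh)" for \<alpha> \<beta> g g' g''
    using interchange[of ?e \<alpha> ?e \<beta>] that e vcomp_ident[OF e] by (auto simp: squares_def)
  then show ?thesis
    using HC.comp_hom[OF f] hcomp_squares[OF e] vident_comp[OF f]
    by (auto simp: is_functor_def)
qed

text \<open>
  The composite \<open>\<alpha>' \<bullet> \<alpha>\<close> does not depend on the representative of the class \<open>[\<alpha>', \<alpha>]\<close>,
  since a generating step of the coend only moves a globular square between the two factors.
\<close>

lemma rep_mu:
  assumes u: "u \<in> hom (VC C) x x'" and u': "u' \<in> hom (VC C) x' x''" and xh: "xh \<in> Ob C"
    and \<alpha>: "\<alpha> \<in> squares C u g g' (Ident (VC C) xh)"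
    and \<alpha>': "\<alpha>' \<in> squares C u' g' g'' (Ident (VC C) xh)"
  shows "PMu (rep C xh) u u' g g'' (pro_class C (rep C xh) u' u g g'' g' \<alpha>' \<alpha>) = Comp (SV C) \<alpha>' \<alpha>"
proof -
  let ?m = "\<lambda>(c, \<beta>', \<beta>). Comp (SV C) \<beta>' \<beta>"
  let ?r = "coend_step (rep_cat C xh x) (rep_cat C xh x') (rep_cat C xh x'')
    (PPro (rep C xh) u') (PPro (rep C xh) u) g g''"
  have dc: "Dom (VC C) u = x" "Cod (VC C) u = x'" "Cod (VC C) u' = x''"
    using u u' by (auto simp: hom_def)
  have cl: "pro_class C (rep C xh) u' u g g'' g' \<alpha>' \<alpha> = (?r \<union> ?r\<inverse>)\<^sup>* `` {(g', \<alpha>', \<alpha>)}"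
    by (simp add: pro_class_def pclass_def coend_eq_def dc Let_def)
  have step: "?m p = ?m q" if "(p, q) \<in> ?r" for p q
  proof -
    from that obtain c d k t' s where
      k: "k \<in> squares C (Ident (VC C) x') c d (Ident (VC C) xh)"
      and t: "t' \<in> squares C u' d g'' (Ident (VC C) xh)"
      and s: "s \<in> squares C u g c (Ident (VC C) xh)"
      and p: "p = (c, Comp (SV C) (Ident (SV C) g'') (Comp (SV C) t' k), s)"
      and q: "q = (d, t', Comp (SV C) k (Comp (SV C) s (Ident (SV C) g)))"
      unfolding coend_step_def by auto
    show ?thesis
      using vcomp_ident(1)[OF vcomp_squares[OF k t]] vcomp_ident(2)[OF s] vcomp_assoc[OF s k t]
      by (simp add: p q)
  qed
  have "?m p = ?m (g', \<alpha>', \<alpha>)" if "((g', \<alpha>', \<alpha>), p) \<in> (?r \<union> ?r\<inverse>)\<^sup>*" for p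
    using that by (induction rule: rtrancl_induct) (use step in fastforce)+
  then have "?m ` pro_class C (rep C xh) u' u g g'' g' \<alpha>' \<alpha> = {Comp (SV C) \<alpha>' \<alpha>}"
    unfolding cl by (auto simp: image_iff split_beta intro!: exI[of _ "(g', \<alpha>', \<alpha>)"])
  then show ?thesis by (simp add: rep_def)
qed

end


section \<open>Transformations and modifications\<close>

lemma mk_htrans_sel:
  shows "x \<in> Ob C \<Longrightarrow> a \<in> Obj (PCat X x) \<Longrightarrow> fob (TFun (mk_htrans C X T P) x) a = fob (T x) a"
    and "x \<in> Ob C \<Longrightarrow> k \<in> Arr (PCat X x) \<Longrightarrow> far (TFun (mk_htrans C X T P) x) k = far (T x) k"
    and "u \<in> hom (VC C) x x' \<Longrightarrow> a \<in> Obj (PCat X x) \<Longrightarrow> a' \<in> Obj (PCat X x') \<Longrightarrow>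
      s \<in> Elt (PPro X u) a a' \<Longrightarrow> TPro (mk_htrans C X T P) u a a' s = P u a a' s"
  by (auto simp: mk_htrans_def func_restrict_def hom_def)

lemma mk_htrans_extensional: "htrans_extensional C X (mk_htrans C X T P)"
  by (auto simp: htrans_extensional_def mk_htrans_def func_restrict_def func_extensional_def hom_def)

lemma htrans_eqI:
  assumes "htrans_extensional C X F" "htrans_extensional C X G"
    and ob: "\<And>x a. x \<in> Ob C \<Longrightarrow> a \<in> Obj (PCat X x) \<Longrightarrow> fob (TFun F x) a = fob (TFun G x) a"
    and ar: "\<And>x k. x \<in> Ob C \<Longrightarrow> k \<in> Arr (PCat X x) \<Longrightarrow> far (TFun F x) k = far (TFun G x) k"
    and pr: "\<And>u x x' a a' s. u \<in> hom (VC C) x x' \<Longrightarrow> a \<in> Obj (PCat X x) \<Longrightarrow>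
      a' \<in> Obj (PCat X x') \<Longrightarrow> s \<in> Elt (PPro X u) a a' \<Longrightarrow> TPro F u a a' s = TPro G u a a' s"
  shows "F = G"
proof -
  note ext = assms(1,2)[unfolded htrans_extensional_def func_extensional_def]
  have "TFun F x = TFun G x" if "x \<in> Ob C" for x
  proof -
    have "fob (TFun F x) = fob (TFun G x)"
      using ext ob that by (intro extensionalityI[where A = "Obj (PCat X x)"]) auto
    moreover have "far (TFun F x) = far (TFun G x)"
      using ext ar that by (intro extensionalityI[where A = "Arr (PCat X x)"]) auto
    ultimately show ?thesis by simp
  qed
  then have "TFun F = TFun G"
    using ext by (intro extensionalityI[where A = "Ob C"]) auto
  moreover have "TPro F u = TPro G u" if "u \<in> Ver C" for u
  proof -
    define x x' where "x = Dom (VC C) u" and "x' = Cod (VC C) u"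
    have u: "u \<in> hom (VC C) x x'" using that by (simp add: hom_def x_def x'_def)
    have e: "TPro H u \<in> extensional (Obj (PCat X x))"
      "a \<in> Obj (PCat X x) \<Longrightarrow> TPro H u a \<in> extensional (Obj (PCat X x'))"
      "a \<in> Obj (PCat X x) \<Longrightarrow> a' \<in> Obj (PCat X x') \<Longrightarrow>
        TPro H u a a' \<in> extensional (Elt (PPro X u) a a')"
      if "H = F \<or> H = G" for H a a'
      using ext u that by blast+
    have "TPro F u a a' = TPro G u a a'" if "a \<in> Obj (PCat X x)" "a' \<in> Obj (PCat X x')" for a a'
      by (rule extensionalityI[OF e(3) e(3)]) (use that pr[OF u that] in auto)
    note e3 = this
    have e2: "TPro F u a = TPro G u a" if "a \<in> Obj (PCat X x)" for a
      by (rule extensionalityI[OF e(2) e(2)]) (use that e3 in auto)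
    show ?thesis
      by (rule extensionalityI[OF e(1) e(1)]) (use e2 in auto)
  qed
  then have "TPro F = TPro G"
    using ext by (intro extensionalityI[where A = "Ver C"]) auto
  ultimately show ?thesis by simp
qed

lemma mk_modif_sel [simp]:
  "MSrc (mk_modif C X F F' K) = F"
  "MTgt (mk_modif C X F F' K) = F'"
  "x \<in> Ob C \<Longrightarrow> a \<in> Obj (PCat X x) \<Longrightarrow> MCmp (mk_modif C X F F' K) x a = K x a"
  by (simp_all add: mk_modif_def)

lemma mk_modif_extensional:
  "MCmp (mk_modif C X F F' K) \<in> extensional (Ob C)"
  "x \<in> Ob C \<Longrightarrow> MCmp (mk_modif C X F F' K) x \<in> extensional (Obj (PCat X x))"
  by (simp_all add: mk_modif_def)

lemma modif_eqI:
  assumes "globular_modification C X Y M" "globular_modification C X Y N"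
    and "MSrc M = MSrc N" "MTgt M = MTgt N"
    and cmp: "\<And>x a. x \<in> Ob C \<Longrightarrow> a \<in> Obj (PCat X x) \<Longrightarrow> MCmp M x a = MCmp N x a"
  shows "M = N"
proof -
  interpret M: globular_modification C X Y M by fact
  interpret N: globular_modification C X Y N by fact
  have "MCmp M x = MCmp N x" if "x \<in> Ob C" for x
    using cmp M.ext_cmp N.ext_cmp that by (intro extensionalityI[where A = "Obj (PCat X x)"]) auto
  then have "MCmp M = MCmp N"
    using M.ext N.ext by (intro extensionalityI[where A = "Ob C"]) auto
  then show ?thesis using assms(3,4) by simp
qed

lemma psh_hom_sel [simp]:
  "Obj (psh_hom C X Y) = {F. horizontal_transformation C X Y F}"
  "Arr (psh_hom C X Y) = {M. globular_modification C X Y M}"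
  "hom (psh_hom C X Y) F G = {M. globular_modification C X Y M \<and> MSrc M = F \<and> MTgt M = G}"
  "Ident (psh_hom C X Y) = modif_id C X Y"
  "Comp (psh_hom C X Y) = modif_vcomp C X Y"
  by (auto simp: psh_hom_def hom_def)

text \<open>
  The axioms of modifications involve the source presheaf through its categories, in naturality,
  and through its restriction functors, in horizontal compatibility; these are recorded for \<open>X\<close>,
  so that a representable is an instance once both are established for it.
\<close>

locale presheaf_hom = double_category C + Y: lax_double_presheaf C Y
  for C :: "('o, 'h, 'v, 's) dcat" and Y :: "('o, 'h, 'v, 's, 'b, 'n) presheaf" +
  fixes X :: "('o, 'h, 'v, 's, 'a, 'm) presheaf"
  assumes X_cat: "\<And>x. x \<in> Ob C \<Longrightarrow> category (PCat X x)"
    and X_fun: "\<And>f x y. f \<in> hom (HC C) x y \<Longrightarrow> is_functor (PCat X y) (PCat X x) (PFun X f)"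
begin

lemma horizontal_objects:
  assumes "f \<in> hom (HC C) x y"
  shows "x \<in> Ob C" "y \<in> Ob C"
  using category.hom_objects[OF cat_HC assms] by auto

lemma modif_component:
  assumes "globular_modification C X Y M" "x \<in> Ob C" "a \<in> Obj (PCat X x)"
  shows "MCmp M x a \<in> hom (PCat Y x) (fob (TFun (MSrc M) x) a) (fob (TFun (MTgt M) x) a)"
  using nat_transD(1)[OF globular_modification.natural[OF assms(1,2)] assms(3)] .

lemma modif_id:
  assumes "horizontal_transformation C X Y F"
  shows "globular_modification C X Y (modif_id C X Y F)"
proof -
  interpret F: horizontal_transformation C X Y F by fact
  have FO: "fob (TFun F x) a \<in> Obj (PCat Y x)" if "x \<in> Ob C" "a \<in> Obj (PCat X x)" for x a
    using is_functorD(1)[OF F.functorial] that by blast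
  show ?thesis
  proof (rule globular_modification.intro, unfold modif_id_def, goal_cases)
    case (5 x)
    interpret A: category "PCat X x" by (rule X_cat[OF 5])
    interpret B: category "PCat Y x" by (rule Y.cat[OF 5])
    have "far (TFun F x) k \<in> hom (PCat Y x) (fob (TFun F x) a) (fob (TFun F x) b)"
      if "k \<in> hom (PCat X x) a b" for k a b
      using is_functor_hom[OF F.functorial[OF 5] _ that] X_cat 5 by blast
    then show ?case
      using 5 B.ident_hom B.ident_left B.ident_right A.hom_objects
      by (simp add: nat_trans_def FO) metis
  next
    case (6 f x y b)
    note xy = horizontal_objects[OF 6(1)]
    then show ?case
      using 6 F.natural_hor[OF 6(1)] is_functorD(2)[OF Y.functorial[OF 6(1)]] FO
        is_functorD(1)[OF X_fun[OF 6(1)]]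
      by (simp add: func_eq_def func_comp_def)
  next
    case (7 u x x' a a' s)
    then show ?case using ver_objects[OF 7(1)] by simp
  qed (simp_all add: assms F.ext mk_modif_extensional)
qed

text \<open>
  In the vertical compatibility of \<open>N\<close> after \<open>M\<close>, first \<open>M\<close> and then \<open>N\<close> passes from the
  target side to the source side. In between, the action of \<open>M\<close> on the source side has to be
  interchanged with that of \<open>N\<close> on the target side.
\<close>

lemma modif_vcomp:
  assumes "globular_modification C X Y M" "globular_modification C X Y N" "MTgt M = MSrc N"
  shows "globular_modification C X Y (modif_vcomp C X Y N M)"
proof -
  interpret M: globular_modification C X Y M by fact
  interpret N: globular_modification C X Y N by fact
  interpret F: horizontal_transformation C X Y "MSrc M" by (rule M.src)
  interpret G: horizontal_transformation C X Y "MTgt M" by (rule M.tgt)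
  interpret H: horizontal_transformation C X Y "MTgt N" by (rule N.tgt)
  note Mh = modif_component[OF assms(1)] and Nh = modif_component[OF assms(2), folded assms(3)]
  show ?thesis
  proof (rule globular_modification.intro, unfold modif_vcomp_def, goal_cases)
    case (5 x)
    interpret A: category "PCat X x" by (rule X_cat[OF 5])
    interpret B: category "PCat Y x" by (rule Y.cat[OF 5])
    have "Comp (PCat Y x) (Comp (PCat Y x) (MCmp N x b) (MCmp M x b)) (far (TFun (MSrc M) x) k) =
      Comp (PCat Y x) (far (TFun (MTgt N) x) k) (Comp (PCat Y x) (MCmp N x a) (MCmp M x a))"
      if k: "k \<in> hom (PCat X x) a b" for k a b
    proof -
      note ob = A.hom_objects[OF k]
      note Fk = is_functor_hom[OF F.functorial[OF 5] A.category_axioms k]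
        and Gk = is_functor_hom[OF G.functorial[OF 5] A.category_axioms k]
        and Hk = is_functor_hom[OF H.functorial[OF 5] A.category_axioms k]
      show ?thesis
        using B.comp_assoc[OF Fk Mh[OF 5 ob(2)] Nh[OF 5 ob(2)]]
          B.comp_assoc[OF Mh[OF 5 ob(1)] Gk Nh[OF 5 ob(2)]]
          B.comp_assoc[OF Mh[OF 5 ob(1)] Nh[OF 5 ob(1)] Hk]
          nat_transD(2)[OF M.natural[OF 5] k] nat_transD(2)[OF N.natural[OF 5] k] assms(3)
        by simp
    qed
    then show ?case
      using 5 A.hom_objects B.comp_hom[OF Mh Nh] by (auto simp: nat_trans_def)
  next
    case (6 f x y b)
    note xy = horizontal_objects[OF 6(1)]
    then show ?case
      using 6 is_functorD(3)[OF Y.functorial[OF 6(1)] Mh[OF xy(2) 6(2)] Nh[OF xy(2) 6(2)]]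
        is_functorD(1)[OF X_fun[OF 6(1)] 6(2)] M.compat_hor[OF 6] N.compat_hor[OF 6]
      by simp
  next
    case (7 u x x' a a' s)
    note u = 7(1) and a = 7(2) and a' = 7(3) and s = 7(4)
    note xx = ver_objects[OF u]
    interpret B: category "PCat Y x" by (rule Y.cat[OF xx(1)])
    interpret B': category "PCat Y x'" by (rule Y.cat[OF xx(2)])
    note P = Y.prof[OF u]
    note split = profunctor_act_split[OF P B.category_axioms B'.category_axioms]
    note Ma = Mh[OF xx(1) a] and Ma' = Mh[OF xx(2) a'] and Na = Nh[OF xx(1) a]
      and Na' = Nh[OF xx(2) a']
    note Fs = prof_natD(1)[OF F.pro[OF u] a a' s] and Gs = prof_natD(1)[OF G.pro[OF u] a a' s]
      and Hs = prof_natD(1)[OF H.pro[OF u] a a' s]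
    note i = B.ident_hom[OF B.hom_objects(1)[OF Ma]] B'.ident_hom[OF B'.hom_objects(2)[OF Na']]
    let ?F = "TPro (MSrc M) u a a' s" and ?G = "TPro (MTgt M) u a a' s"
      and ?H = "TPro (MTgt N) u a a' s"
    let ?A = "Act (PPro Y u)"
    let ?i = "\<lambda>F. Ident (PCat Y x) (fob (TFun F x) a)"
    let ?i' = "\<lambda>F. Ident (PCat Y x') (fob (TFun F x') a')"
    have "?A (?i (MSrc M)) (Comp (PCat Y x') (MCmp N x' a') (MCmp M x' a')) ?F =
        ?A (?i (MSrc M)) (MCmp N x' a') (?A (?i (MSrc M)) (MCmp M x' a') ?F)"
      using profunctorD(2)[OF P i(1) i(1) Ma' Na' Fs] B.ident_left[OF i(1)] by simp
    also have "\<dots> = ?A (?i (MSrc M)) (MCmp N x' a') (?A (MCmp M x a) (?i' (MTgt M)) ?G)"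
      using M.compat_ver[OF u a a' s] by simp
    also have "\<dots> = ?A (MCmp M x a) (?i' (MTgt N)) (?A (?i (MTgt M)) (MCmp N x' a') ?G)"
      using split[OF Ma Na' Gs] by simp
    also have "\<dots> = ?A (MCmp M x a) (?i' (MTgt N)) (?A (MCmp N x a) (?i' (MTgt N)) ?H)"
      using N.compat_ver[OF u a a' s] assms(3) by simp
    also have "\<dots> = ?A (Comp (PCat Y x) (MCmp N x a) (MCmp M x a)) (?i' (MTgt N)) ?H"
      using profunctorD(2)[OF P Na Ma i(2) i(2) Hs] B'.ident_left[OF i(2)] by simp
    finally show ?case using a a' xx by simp
  qed (simp_all add: M.src N.tgt mk_modif_extensional)
qed

lemma category_psh_hom: "category (psh_hom C X Y)"
proof (unfold_locales, goal_cases)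
  case (1 M)
  then show ?case using globular_modification.src by (auto simp: psh_hom_def)
next
  case (2 M)
  then show ?case using globular_modification.tgt by (auto simp: psh_hom_def)
next
  case (3 F)
  then show ?case using modif_id by (simp add: modif_id_def)
next
  case (4 M N F G H)
  then show ?case using modif_vcomp[of M N] by (simp add: modif_vcomp_def)
next
  case (5 M F G)
  then have M: "globular_modification C X Y M" by simp
  have I: "globular_modification C X Y (modif_id C X Y G)"
    using 5 modif_id globular_modification.tgt[OF M] by auto
  show ?case
    using 5 modif_vcomp[OF M I] M category.ident_left[OF Y.cat modif_component[OF M]]
    by (auto intro!: modif_eqI[of C X Y] simp: modif_id_def modif_vcomp_def)
next
  case (6 M F G)
  then have M: "globular_modification C X Y M" by simp
  have I: "globular_modification C X Y (modif_id C X Y F)"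
    using 6 modif_id globular_modification.src[OF M] by auto
  show ?case
    using 6 modif_vcomp[OF I M] M category.ident_right[OF Y.cat modif_component[OF M]]
    by (auto intro!: modif_eqI[of C X Y] simp: modif_id_def modif_vcomp_def)
next
  case (7 M N L F G H K)
  then have M: "globular_modification C X Y M" and N: "globular_modification C X Y N"
    and L: "globular_modification C X Y L"
    and st: "MTgt M = MSrc N" "MTgt N = MSrc L" by auto
  have cmp: "Comp (PCat Y x) (MCmp L x a) (Comp (PCat Y x) (MCmp N x a) (MCmp M x a)) =
      Comp (PCat Y x) (Comp (PCat Y x) (MCmp L x a) (MCmp N x a)) (MCmp M x a)"
    if "x \<in> Ob C" "a \<in> Obj (PCat X x)" for x a
    using category.comp_assoc[OF Y.cat] modif_component[OF M that] modif_component[OF N that]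
      modif_component[OF L that] that st by metis
  have "globular_modification C X Y (modif_vcomp C X Y L (modif_vcomp C X Y N M))"
    using modif_vcomp[OF modif_vcomp[OF M N st(1)] L] st by (simp add: modif_vcomp_def)
  moreover have "globular_modification C X Y (modif_vcomp C X Y (modif_vcomp C X Y L N) M)"
    using modif_vcomp[OF M modif_vcomp[OF N L st(2)]] st by (simp add: modif_vcomp_def)
  ultimately show ?case
    using cmp by (auto intro!: modif_eqI[of C X Y] simp: modif_vcomp_def)
qed

end


section \<open>Evaluation at the identity\<close>

definition eval_at_ident :: "('o, 'h, 'v, 's) dcat \<Rightarrow> ('o, 'h, 'v, 's, 'a, 'm) yoneda_family" where
  "eval_at_ident C xh X =
     \<lparr>fob = (\<lambda>F. fob (TFun F xh) (Ident (HC C) xh)), far = (\<lambda>M. MCmp M xh (Ident (HC C) xh))\<rparr>"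

text \<open>
  Although \<open>glob_cmp\<close> is named for globular squares, its formula \<open>(X\<alpha>)\<^sub>a\<^sub>,\<^sub>a(1\<^sub>a)\<close> makes sense
  for every square \<open>\<alpha>\<close> whose right boundary is the identity of \<open>xh\<close>, and is applied to such
  squares throughout.
\<close>

definition yoneda_htrans :: "('o, 'h, 'v, 's) dcat \<Rightarrow> 'o \<Rightarrow>
    ('o, 'h, 'v, 's, 'a, 'm) presheaf \<Rightarrow> 'a \<Rightarrow> ('o, 'v, 'h, 's, 'a, 'm) htrans" where
  "yoneda_htrans C xh X a =
     mk_htrans C (rep C xh)
       (\<lambda>x. \<lparr>fob = (\<lambda>g. fob (PFun X g) a), far = (\<lambda>\<eta>. glob_cmp X xh \<eta> a)\<rparr>)
       (\<lambda>u g g' \<alpha>. glob_cmp X xh \<alpha> a)"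

definition yoneda_modif :: "('o, 'h, 'v, 's) dcat \<Rightarrow> 'o \<Rightarrow>
    ('o, 'h, 'v, 's, 'a, 'm) presheaf \<Rightarrow> 'm \<Rightarrow> ('o, 'v, 'h, 's, 'a, 'm) modif" where
  "yoneda_modif C xh X k =
     mk_modif C (rep C xh) (yoneda_htrans C xh X (Dom (PCat X xh) k))
       (yoneda_htrans C xh X (Cod (PCat X xh) k)) (\<lambda>x g. far (PFun X g) k)"

locale yoneda = double_category C + X: lax_double_presheaf C X
  for C :: "('o, 'h, 'v, 's) dcat" and X :: "('o, 'h, 'v, 's, 'a, 'm) presheaf" +
  fixes xh :: 'o
  assumes xh: "xh \<in> Ob C"
begin

sublocale presheaf_hom C X "rep C xh"
proof (rule presheaf_hom.intro[OF double_category_axioms X.lax_double_presheaf_axioms],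
    rule presheaf_hom_axioms.intro)
  show "category (PCat (rep C xh) x)" if "x \<in> Ob C" for x
    using category_rep_cat[OF that xh] by simp
  show "is_functor (PCat (rep C xh) y) (PCat (rep C xh) x) (PFun (rep C xh) f)"
    if "f \<in> hom (HC C) x y" for f x y
    using rep_functor[OF that xh] .
qed

abbreviation "e \<equiv> Ident (VC C)"
abbreviation "value_at \<alpha> a \<equiv> glob_cmp X xh \<alpha> a"

lemma fun_obj: "f \<in> hom (HC C) x y \<Longrightarrow> a \<in> Obj (PCat X y) \<Longrightarrow> fob (PFun X f) a \<in> Obj (PCat X x)"
  using is_functorD(1)[OF X.functorial] .

lemma value_elt:
  assumes \<alpha>: "\<alpha> \<in> squares C u g g' (e xh)" and u: "u \<in> hom (VC C) x x'"
    and a: "a \<in> Obj (PCat X xh)"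
  shows "value_at \<alpha> a \<in> Elt (PPro X u) (fob (PFun X g) a) (fob (PFun X g') a)"
  using prof_natD(1)[OF X.sq[OF \<alpha> ver_ident[OF xh]] a a] X.normal_elt[OF xh a a]
    category.ident_hom[OF X.cat[OF xh] a]
  by (simp add: glob_cmp_def)

lemma value_hom:
  assumes \<eta>: "\<eta> \<in> squares C (e x) g g' (e xh)" and x: "x \<in> Ob C" and a: "a \<in> Obj (PCat X xh)"
  shows "value_at \<eta> a \<in> hom (PCat X x) (fob (PFun X g) a) (fob (PFun X g') a)"
proof -
  note gg = squares_boundary[OF \<eta> ver_ident[OF x] ver_ident[OF xh]]
  show ?thesis
    using value_elt[OF \<eta> ver_ident[OF x] a] X.normal_elt[OF x fun_obj[OF gg(1) a] fun_obj[OF gg(2) a]]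
    by simp
qed

text \<open>
  The unit \<open>1\<^sub>a\<close> is \<open>\<mu>[1\<^sub>a, 1\<^sub>a]\<close> by normality, so naturality of \<open>\<mu>\<close> distributes \<open>X\<close> of a
  vertical composite over the two factors.
\<close>

lemma value_vcomp:
  assumes \<alpha>: "\<alpha> \<in> squares C u g g' (e xh)" and \<alpha>': "\<alpha>' \<in> squares C u' g' g'' (e xh)"
    and a: "a \<in> Obj (PCat X xh)"
  shows "value_at (Comp (SV C) \<alpha>' \<alpha>) a =
    PMu X u u' (fob (PFun X g) a) (fob (PFun X g'') a)
      (pro_class C X u' u (fob (PFun X g) a) (fob (PFun X g'') a) (fob (PFun X g') a)
        (value_at \<alpha>' a) (value_at \<alpha> a))"
proof -
  interpret B: category "PCat X xh" by (rule X.cat[OF xh])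
  note e = ver_ident[OF xh] and i = B.ident_hom[OF a]
  have i': "Ident (PCat X xh) a \<in> Elt (PPro X (e xh)) a a"
    using i X.normal_elt[OF xh a a] by simp
  have "PMu X (e xh) (e xh) a a (pro_class C X (e xh) (e xh) a a a
      (Ident (PCat X xh) a) (Ident (PCat X xh) a)) = Ident (PCat X xh) a"
    using X.mu_ident_left[OF e i a i'] profunctorD(3)[OF X.prof[OF e] a a i'] by simp
  then show ?thesis
    using X.mu_natural[OF \<alpha> \<alpha>' e e a a a i' i'] by (simp add: glob_cmp_def)
qed

text \<open>
  When one of the factors is globular, normality identifies \<open>\<mu>\<close> with the co-Yoneda isomorphism,
  that is, with the action of the value of the globular factor.
\<close>

lemma value_act_source:
  assumes \<eta>: "\<eta> \<in> squares C (e x) g h (e xh)" and \<alpha>: "\<alpha> \<in> squares C u h g' (e xh)"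
    and u: "u \<in> hom (VC C) x x'" and a: "a \<in> Obj (PCat X xh)"
  shows "value_at (Comp (SV C) \<alpha> \<eta>) a =
    Act (PPro X u) (value_at \<eta> a) (Ident (PCat X x') (fob (PFun X g') a)) (value_at \<alpha> a)"
  using value_vcomp[OF \<eta> \<alpha> a] value_elt[OF \<alpha> u a]
    X.mu_ident_left[OF u value_hom[OF \<eta> ver_objects(1)[OF u] a]]
    fun_obj[OF squares_boundary(2)[OF \<alpha> u ver_ident[OF xh]] a]
  by simp

lemma value_act_target:
  assumes \<eta>: "\<eta> \<in> squares C (e x') h g' (e xh)" and \<alpha>: "\<alpha> \<in> squares C u g h (e xh)"
    and u: "u \<in> hom (VC C) x x'" and a: "a \<in> Obj (PCat X xh)"
  shows "value_at (Comp (SV C) \<eta> \<alpha>) a =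
    Act (PPro X u) (Ident (PCat X x) (fob (PFun X g) a)) (value_at \<eta> a) (value_at \<alpha> a)"
  using value_vcomp[OF \<alpha> \<eta> a] value_elt[OF \<alpha> u a]
    X.mu_ident_right[OF u _ value_hom[OF \<eta> ver_objects(2)[OF u] a]]
    fun_obj[OF squares_boundary(1)[OF \<alpha> u ver_ident[OF xh]] a]
  by simp

lemma value_hcomp:
  assumes \<alpha>: "\<alpha> \<in> squares C u f f' v" and \<beta>: "\<beta> \<in> squares C v g g' (e xh)"
    and a: "a \<in> Obj (PCat X xh)"
  shows "value_at (Comp (SH C) \<beta> \<alpha>) a =
    PSq X \<alpha> (fob (PFun X g) a) (fob (PFun X g') a) (value_at \<beta> a)"
  using X.sq_comp[OF \<alpha> \<beta> ver_ident[OF xh] a a] X.normal_elt[OF xh a a]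
    category.ident_hom[OF X.cat[OF xh] a]
  by (simp add: glob_cmp_def)

text \<open>
  Both sides equal \<open>(X\<alpha>)\<^sub>a\<^sub>,\<^sub>b(k)\<close>: the arrow \<open>k\<close> is the action of \<open>k\<close> on \<open>1\<^sub>a\<close> from the
  target side as well as on \<open>1\<^sub>b\<close> from the source side.
\<close>

lemma value_slide:
  assumes \<alpha>: "\<alpha> \<in> squares C u g g' (e xh)" and u: "u \<in> hom (VC C) x x'"
    and k: "k \<in> hom (PCat X xh) a b"
  shows "Act (PPro X u) (Ident (PCat X x) (fob (PFun X g) a)) (far (PFun X g') k) (value_at \<alpha> a) =
    Act (PPro X u) (far (PFun X g) k) (Ident (PCat X x') (fob (PFun X g') b)) (value_at \<alpha> b)"
proof -
  interpret B: category "PCat X xh" by (rule X.cat[OF xh])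
  note ob = B.hom_objects[OF k]
  note i = B.ident_hom[OF ob(1)] and j = B.ident_hom[OF ob(2)]
  note gg = squares_boundary[OF \<alpha> u ver_ident[OF xh]]
  have elt: "hom (PCat X xh) c c \<subseteq> Elt (PPro X (e xh)) c c" if "c \<in> Obj (PCat X xh)" for c
    using X.normal_elt[OF xh that that] by simp
  have "Act (PPro X (e xh)) (Ident (PCat X xh) a) k (Ident (PCat X xh) a) = k"
    using X.normal_act[OF xh i k i] B.ident_right[OF k] B.ident_left[OF i] by simp
  moreover have "Act (PPro X (e xh)) k (Ident (PCat X xh) b) (Ident (PCat X xh) b) = k"
    using X.normal_act[OF xh k j j] B.ident_left[OF k] by simp
  ultimately show ?thesis
    using prof_natD(2)[OF X.sq[OF \<alpha> ver_ident[OF xh]] i k subsetD[OF elt[OF ob(1)] i]]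
      prof_natD(2)[OF X.sq[OF \<alpha> ver_ident[OF xh]] k j subsetD[OF elt[OF ob(2)] j]]
      is_functorD(2)[OF X.functorial[OF gg(1)] ob(1)]
      is_functorD(2)[OF X.functorial[OF gg(2)] ob(2)]
    by (simp add: glob_cmp_def)
qed

lemma yoneda_htrans_sel:
  shows "g \<in> hom (HC C) x xh \<Longrightarrow> fob (TFun (yoneda_htrans C xh X a) x) g = fob (PFun X g) a"
    and "x \<in> Ob C \<Longrightarrow> \<eta> \<in> squares C (e x) g g' (e xh) \<Longrightarrow>
      far (TFun (yoneda_htrans C xh X a) x) \<eta> = value_at \<eta> a"
    and "u \<in> hom (VC C) x x' \<Longrightarrow> \<alpha> \<in> squares C u g g' (e xh) \<Longrightarrow>
      TPro (yoneda_htrans C xh X a) u g g' \<alpha> = value_at \<alpha> a"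
proof -
  show "fob (TFun (yoneda_htrans C xh X a) x) g = fob (PFun X g) a" if "g \<in> hom (HC C) x xh"
    using that horizontal_objects[OF that] by (simp add: yoneda_htrans_def mk_htrans_sel)
  show "far (TFun (yoneda_htrans C xh X a) x) \<eta> = value_at \<eta> a"
    if "x \<in> Ob C" "\<eta> \<in> squares C (e x) g g' (e xh)"
    using that by (simp add: yoneda_htrans_def mk_htrans_sel squares_def rep_cat_def)
  show "TPro (yoneda_htrans C xh X a) u g g' \<alpha> = value_at \<alpha> a"
    if "u \<in> hom (VC C) x x'" "\<alpha> \<in> squares C u g g' (e xh)"
    using that squares_boundary[OF that(2,1) ver_ident[OF xh]]
    by (simp add: yoneda_htrans_def mk_htrans_sel)
qed

lemma yoneda_htrans_functor:
  assumes x: "x \<in> Ob C" and a: "a \<in> Obj (PCat X xh)"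
  shows "is_functor (rep_cat C xh x) (PCat X x) (TFun (yoneda_htrans C xh X a) x)"
proof -
  interpret A: category "PCat X x" by (rule X.cat[OF x])
  note sel = yoneda_htrans_sel
  have bd: "g \<in> hom (HC C) x xh \<and> g' \<in> hom (HC C) x xh"
    if "\<eta> \<in> squares C (e x) g g' (e xh)" for \<eta> g g'
    using squares_boundary[OF that ver_ident[OF x] ver_ident[OF xh]] by simp
  have id: "value_at (Ident (SV C) g) a = Ident (PCat X x) (fob (PFun X g) a)"
    if "g \<in> hom (HC C) x xh" for g
    using X.normal_sq[OF that category.ident_hom[OF X.cat[OF xh] a]]
      is_functorD(2)[OF X.functorial[OF that] a]
    by (simp add: glob_cmp_def)
  have comp: "value_at (Comp (SV C) \<theta> \<eta>) a = Comp (PCat X x) (value_at \<theta> a) (value_at \<eta> a)"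
    if \<eta>: "\<eta> \<in> squares C (e x) g g' (e xh)" and \<theta>: "\<theta> \<in> squares C (e x) g' g'' (e xh)"
    for \<eta> \<theta> g g' g''
  proof -
    note h\<eta> = value_hom[OF \<eta> x a] and h\<theta> = value_hom[OF \<theta> x a]
    note i = A.ident_hom[OF A.hom_objects(2)[OF h\<theta>]]
    show ?thesis
      using value_act_source[OF \<eta> \<theta> ver_ident[OF x] a] X.normal_act[OF x h\<eta> i h\<theta>]
        A.ident_left[OF A.comp_hom[OF h\<eta> h\<theta>]]
      by simp
  qed
  have comp_sq: "Comp (SV C) \<theta> \<eta> \<in> squares C (e x) g g'' (e xh)"
    if "\<eta> \<in> squares C (e x) g g' (e xh)" "\<theta> \<in> squares C (e x) g' g'' (e xh)" for \<eta> \<theta> g g' g''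
    using vcomp_squares[OF that] by (simp add: ver_ident_comp x xh)
  show ?thesis
    unfolding is_functor_def
  proof (intro conjI ballI allI impI, goal_cases)
    case (1 g)
    then show ?case using fun_obj[OF _ a] by (simp add: sel)
  next
    case (2 g g' \<eta>)
    then have \<eta>: "\<eta> \<in> squares C (e x) g g' (e xh)" by simp
    then show ?case using value_hom[OF \<eta> x a] bd[OF \<eta>] by (simp add: sel sel(2)[OF x \<eta>])
  next
    case (3 g)
    then have g: "g \<in> hom (HC C) x xh" by simp
    show ?case using id[OF g] sel(2)[OF x vident_squares[OF g]] g by (simp add: sel(1))
  next
    case (4 g g' g'' \<eta> \<theta>)
    then have \<eta>: "\<eta> \<in> squares C (e x) g g' (e xh)" and \<theta>: "\<theta> \<in> squares C (e x) g' g'' (e xh)"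
      by simp_all
    show ?case
      using comp[OF \<eta> \<theta>] sel(2)[OF x \<eta>] sel(2)[OF x \<theta>] sel(2)[OF x comp_sq[OF \<eta> \<theta>]] by simp
  qed
qed

text \<open>
  The representable acts by \<open>\<alpha> \<mapsto> \<eta>' \<bullet> \<alpha> \<bullet> \<eta>\<close>, so naturality combines the two cases of a
  vertical composite with a globular factor.
\<close>

lemma yoneda_htrans_prof_nat:
  assumes u: "u \<in> hom (VC C) x x'" and a: "a \<in> Obj (PCat X xh)"
  shows "prof_nat (rep_cat C xh x) (rep_cat C xh x') (PPro (rep C xh) u)
    (TFun (yoneda_htrans C xh X a) x) (TFun (yoneda_htrans C xh X a) x') (PPro X u)
    (TPro (yoneda_htrans C xh X a) u)"
proof -
  note sel = yoneda_htrans_sel and xx = ver_objects[OF u]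
  have "TPro (yoneda_htrans C xh X a) u h h' (Comp (SV C) \<eta>' (Comp (SV C) \<alpha> \<eta>)) =
    Act (PPro X u) (value_at \<eta> a) (value_at \<eta>' a) (value_at \<alpha> a)"
    if \<eta>: "\<eta> \<in> squares C (e x) h g (e xh)" and \<eta>': "\<eta>' \<in> squares C (e x') g' h' (e xh)"
      and \<alpha>: "\<alpha> \<in> squares C u g g' (e xh)" for \<eta> \<eta>' \<alpha> g g' h h'
  proof -
    have \<alpha>\<eta>: "Comp (SV C) \<alpha> \<eta> \<in> squares C u h g' (e xh)"
      using vcomp_squares[OF \<eta> \<alpha>] category.ident_right[OF cat_VC u] xh by (simp add: ver_ident_comp)
    have all: "Comp (SV C) \<eta>' (Comp (SV C) \<alpha> \<eta>) \<in> squares C u h h' (e xh)"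
      using vcomp_squares[OF \<alpha>\<eta> \<eta>'] category.ident_left[OF cat_VC u] xh by (simp add: ver_ident_comp)
    show ?thesis
      using sel(3)[OF u all] value_act_target[OF \<eta>' \<alpha>\<eta> u a] value_act_source[OF \<eta> \<alpha> u a]
        profunctor_act_split(1)[OF X.prof[OF u] X.cat[OF xx(1)] X.cat[OF xx(2)]
          value_hom[OF \<eta> xx(1) a] value_hom[OF \<eta>' xx(2) a] value_elt[OF \<alpha> u a]]
      by simp
  qed
  moreover have "TPro (yoneda_htrans C xh X a) u g g' \<alpha> \<in>
      Elt (PPro X u) (fob (TFun (yoneda_htrans C xh X a) x) g) (fob (TFun (yoneda_htrans C xh X a) x') g')"
    if \<alpha>: "\<alpha> \<in> squares C u g g' (e xh)" for \<alpha> g g'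
    using value_elt[OF \<alpha> u a] squares_boundary[OF \<alpha> u ver_ident[OF xh]] sel(3)[OF u \<alpha>]
    by (simp add: sel(1))
  ultimately show ?thesis
    by (simp add: prof_nat_def sel(2)[OF xx(1)] sel(2)[OF xx(2)] sel(3)[OF u])
qed

text \<open>
  The horizontal conditions are functoriality of \<open>X\<close> for horizontal composition; compatibility
  with \<open>\<mu>\<close> is the formula for the value of a vertical composite.
\<close>

lemma horizontal_transformation_yoneda_htrans:
  assumes a: "a \<in> Obj (PCat X xh)"
  shows "horizontal_transformation C (rep C xh) X (yoneda_htrans C xh X a)"
proof (rule horizontal_transformation.intro, goal_cases)
  case 1
  show ?case by (simp add: yoneda_htrans_def mk_htrans_extensional)
next
  case (2 x)
  then show ?case using yoneda_htrans_functor[OF _ a] by simp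
next
  case (3 u x x')
  then show ?case using yoneda_htrans_prof_nat[OF _ a] by simp
next
  case (4 f x y)
  note xy = horizontal_objects[OF 4]
  have "fob (TFun (yoneda_htrans C xh X a) x) (Comp (HC C) g f) =
      fob (PFun X f) (fob (TFun (yoneda_htrans C xh X a) y) g)" if g: "g \<in> hom (HC C) y xh" for g
    using X.fun_comp[OF 4 g] category.comp_hom[OF cat_HC 4 g] g a
    by (simp add: yoneda_htrans_sel(1) func_eq_def func_comp_def)
  moreover have "far (TFun (yoneda_htrans C xh X a) x) (Comp (SH C) \<eta> (Ident (SV C) f)) =
      far (PFun X f) (far (TFun (yoneda_htrans C xh X a) y) \<eta>)"
    if \<eta>: "\<eta> \<in> squares C (e y) g g' (e xh)" for \<eta> g g'
    using yoneda_htrans_sel(2)[OF xy(1) hcomp_squares[OF vident_squares[OF 4] \<eta>]]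
      yoneda_htrans_sel(2)[OF xy(2) \<eta>] value_hcomp[OF vident_squares[OF 4] \<eta> a]
      X.normal_sq[OF 4 value_hom[OF \<eta> xy(2) a]]
    by simp
  ultimately show ?case
    using rep_cat_arr by (fastforce simp: func_eq_def func_comp_def)
next
  case (5 \<alpha> u f f' v y y' g g' \<beta>)
  then have \<alpha>: "\<alpha> \<in> squares C u f f' v" and v: "v \<in> hom (VC C) y y'"
    and g: "g \<in> hom (HC C) y xh" "g' \<in> hom (HC C) y' xh"
    and \<beta>: "\<beta> \<in> squares C v g g' (e xh)" by simp_all
  have u: "u \<in> hom (VC C) (Dom (VC C) u) (Cod (VC C) u)"
    using \<alpha> category.dom_obj[OF cat_SH] by (auto simp: squares_def hom_def obj_SH)
  show ?case
    using yoneda_htrans_sel(3)[OF u hcomp_squares[OF \<alpha> \<beta>]] yoneda_htrans_sel(3)[OF v \<beta>]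
      value_hcomp[OF \<alpha> \<beta> a] g
    by (simp add: yoneda_htrans_sel(1))
next
  case (6 u u' x x' x'' g g' g'' \<alpha> \<alpha>')
  then have u: "u \<in> hom (VC C) x x'" and u': "u' \<in> hom (VC C) x' x''"
    and g: "g \<in> hom (HC C) x xh" "g' \<in> hom (HC C) x' xh" "g'' \<in> hom (HC C) x'' xh"
    and \<alpha>: "\<alpha> \<in> squares C u g g' (e xh)" and \<alpha>': "\<alpha>' \<in> squares C u' g' g'' (e xh)"
    by simp_all
  have "Comp (SV C) \<alpha>' \<alpha> \<in> squares C (Comp (VC C) u' u) g g'' (e xh)"
    using vcomp_squares[OF \<alpha> \<alpha>'] by (simp add: ver_ident_comp xh)
  then show ?case
    using yoneda_htrans_sel(3)[OF category.comp_hom[OF cat_VC u u']] value_vcomp[OF \<alpha> \<alpha>' a]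
      rep_mu[OF u u' xh \<alpha> \<alpha>'] yoneda_htrans_sel(3)[OF u \<alpha>] yoneda_htrans_sel(3)[OF u' \<alpha>'] g
    by (simp add: yoneda_htrans_sel(1))
next
  case (7 x g g' \<eta>)
  then have x: "x \<in> Ob C" and \<eta>: "\<eta> \<in> squares C (e x) g g' (e xh)" by simp_all
  show ?case
    using yoneda_htrans_sel(2)[OF x \<eta>] yoneda_htrans_sel(3)[OF ver_ident[OF x] \<eta>] by simp
qed


lemma hor_ident: "Ident (HC C) xh \<in> hom (HC C) xh xh"
  using category.ident_hom[OF cat_HC xh] .

text \<open>
  Naturality at \<open>x\<close> is the vertical compatibility at \<open>e\<^sub>x\<close>, because the actions on a hom functor are
  composition; both are instances of sliding \<open>k\<close> along a square.
\<close>

lemma globular_modification_yoneda_modif: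
  assumes k: "k \<in> hom (PCat X xh) a b"
  shows "globular_modification C (rep C xh) X (yoneda_modif C xh X k)"
proof -
  interpret B: category "PCat X xh" by (rule X.cat[OF xh])
  note ob = B.hom_objects[OF k]
  have dc: "Dom (PCat X xh) k = a" "Cod (PCat X xh) k = b" using k by (simp_all add: hom_def)
  have Xk: "far (PFun X g) k \<in> hom (PCat X x) (fob (PFun X g) a) (fob (PFun X g) b)"
    if "g \<in> hom (HC C) x xh" for g x
    using is_functor_hom[OF X.functorial[OF that] B.category_axioms k] .
  have cmp: "MCmp (yoneda_modif C xh X k) x g = far (PFun X g) k" if "g \<in> hom (HC C) x xh" for g x
    using that horizontal_objects[OF that] by (simp add: yoneda_modif_def)
  show ?thesis
  proof (rule globular_modification.intro, goal_cases)
    case 1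
    show ?case using horizontal_transformation_yoneda_htrans[OF ob(1)] by (simp add: yoneda_modif_def dc)
  next
    case 2
    show ?case using horizontal_transformation_yoneda_htrans[OF ob(2)] by (simp add: yoneda_modif_def dc)
  next
    case 3
    show ?case by (simp add: yoneda_modif_def mk_modif_extensional)
  next
    case (4 x)
    then show ?case by (simp add: yoneda_modif_def mk_modif_extensional del: rep_sel)
  next
    case (5 x)
    interpret A: category "PCat X x" by (rule X.cat[OF 5])
    have "Comp (PCat X x) (far (PFun X g') k) (value_at \<eta> a) =
        Comp (PCat X x) (value_at \<eta> b) (far (PFun X g) k)"
      if \<eta>: "\<eta> \<in> squares C (e x) g g' (e xh)" for \<eta> g g'
    proof -
      note gg = squares_boundary[OF \<eta> ver_ident[OF 5] ver_ident[OF xh]]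
      note va = value_hom[OF \<eta> 5 ob(1)] and vb = value_hom[OF \<eta> 5 ob(2)]
      note i = A.ident_hom[OF A.hom_objects(1)[OF va]] A.ident_hom[OF A.hom_objects(2)[OF vb]]
      show ?thesis
        using value_slide[OF \<eta> ver_ident[OF 5] k] X.normal_act[OF 5 i(1) Xk[OF gg(2)] va]
          X.normal_act[OF 5 Xk[OF gg(1)] i(2) vb] A.ident_right[OF va]
          A.ident_left[OF A.comp_hom[OF Xk[OF gg(1)] vb]]
        by simp
    qed
    then show ?case
      using Xk cmp squares_boundary[OF _ ver_ident[OF 5] ver_ident[OF xh]]
      by (auto simp: nat_trans_def yoneda_modif_def dc yoneda_htrans_sel(1) yoneda_htrans_sel(2)[OF 5] 5)
  next
    case (6 f x y g)
    then have g: "g \<in> hom (HC C) y xh" by simp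
    have "k \<in> Arr (PCat X xh)" using k by (simp add: hom_def)
    then show ?case
      using X.fun_comp[OF 6(1) g] cmp[OF g] cmp[OF category.comp_hom[OF cat_HC 6(1) g]]
      by (simp add: func_eq_def func_comp_def)
  next
    case (7 u x x' g g' \<alpha>)
    then have \<alpha>: "\<alpha> \<in> squares C u g g' (e xh)" by simp
    note gg = squares_boundary[OF \<alpha> 7(1) ver_ident[OF xh]]
    show ?case
      using value_slide[OF \<alpha> 7(1) k] cmp[OF gg(1)] cmp[OF gg(2)] yoneda_htrans_sel(3)[OF 7(1) \<alpha>] gg
      by (simp add: yoneda_htrans_sel(1)) (simp add: yoneda_modif_def dc yoneda_htrans_sel(1))
  qed
qed

lemma yoneda_modif_sel:
  assumes "k \<in> hom (PCat X xh) a b"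
  shows "MSrc (yoneda_modif C xh X k) = yoneda_htrans C xh X a"
    and "MTgt (yoneda_modif C xh X k) = yoneda_htrans C xh X b"
    and "g \<in> hom (HC C) x xh \<Longrightarrow> MCmp (yoneda_modif C xh X k) x g = far (PFun X g) k"
  using assms horizontal_objects[of g x xh] by (auto simp: yoneda_modif_def hom_def)

text \<open>
  This is the uniqueness half of the Yoneda lemma: \<open>g = 1\<^sub>x\<^sub>h \<circ> g\<close>, and \<open>\<alpha> = 1 \<circ> \<alpha>\<close> with the
  identity square of \<open>e\<^sub>x\<^sub>h\<close>, which is also the identity arrow of \<open>1\<^sub>x\<^sub>h\<close> in the category
  \<open>C(xh,xh)\<close>. Naturality moves the restriction along \<open>g\<close> or \<open>\<alpha>\<close> out of \<open>F\<close>, and \<open>F\<close>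
  sends the identity arrow to \<open>1\<^sub>a\<close>.
\<close>

lemma transformation_determined:
  assumes "horizontal_transformation C (rep C xh) X F"
  shows "g \<in> hom (HC C) x xh \<Longrightarrow>
      fob (TFun F x) g = fob (PFun X g) (fob (TFun F xh) (Ident (HC C) xh))"
    and "u \<in> hom (VC C) x x' \<Longrightarrow> \<alpha> \<in> squares C u g g' (e xh) \<Longrightarrow>
      TPro F u g g' \<alpha> = value_at \<alpha> (fob (TFun F xh) (Ident (HC C) xh))"
proof -
  interpret F: horizontal_transformation C "rep C xh" X F by fact
  let ?i = "Ident (HC C) xh" and ?I = "Ident (SV C) (Ident (HC C) xh)"
  show "fob (TFun F x) g = fob (PFun X g) (fob (TFun F xh) ?i)" if "g \<in> hom (HC C) x xh"
    using F.natural_hor[OF that] hor_ident category.ident_left[OF cat_HC that]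
    by (force simp: func_eq_def func_comp_def)
  assume u: "u \<in> hom (VC C) x x'" and \<alpha>: "\<alpha> \<in> squares C u g g' (e xh)"
  note gg = squares_boundary[OF \<alpha> u ver_ident[OF xh]]
  have I: "?I \<in> squares C (e xh) ?i ?i (e xh)" by (rule vident_squares[OF hor_ident])
  have "TPro F u (Comp (HC C) ?i g) (Comp (HC C) ?i g') (Comp (SH C) ?I \<alpha>) =
      PSq X \<alpha> (fob (TFun F xh) ?i) (fob (TFun F xh) ?i) (TPro F (e xh) ?i ?i ?I)"
    using F.natural_sq[OF \<alpha> ver_ident[OF xh], of ?i ?i ?I] I hor_ident by simp
  moreover have "TPro F (e xh) ?i ?i ?I = Ident (PCat X xh) (fob (TFun F xh) ?i)"
    using F.normal[OF xh, of ?I ?i ?i] I is_functorD(2)[OF F.functorial[OF xh], of ?i] hor_ident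
    by simp
  ultimately show "TPro F u g g' \<alpha> = value_at \<alpha> (fob (TFun F xh) ?i)"
    using category.ident_left[OF cat_HC gg(1)] category.ident_left[OF cat_HC gg(2)]
      hcomp_ident(1)[OF \<alpha>] ident_ident[OF xh]
    by (simp add: glob_cmp_def)
qed

lemma transformation_determined_glob:
  assumes F: "horizontal_transformation C (rep C xh) X F"
    and x: "x \<in> Ob C" and \<eta>: "\<eta> \<in> squares C (e x) g g' (e xh)"
  shows "far (TFun F x) \<eta> = value_at \<eta> (fob (TFun F xh) (Ident (HC C) xh))"
  using transformation_determined(2)[OF F ver_ident[OF x] \<eta>]
    horizontal_transformation.normal[OF F x, of \<eta> g g'] \<eta>
  by simp

lemma modification_determined:
  assumes M: "globular_modification C (rep C xh) X M" and g: "g \<in> hom (HC C) x xh"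
  shows "MCmp M x g = far (PFun X g) (MCmp M xh (Ident (HC C) xh))"
  using globular_modification.compat_hor[OF M g, of "Ident (HC C) xh"] hor_ident
    category.ident_left[OF cat_HC g]
  by simp

lemma eval_obj:
  assumes "horizontal_transformation C (rep C xh) X F"
  shows "fob (TFun F xh) (Ident (HC C) xh) \<in> Obj (PCat X xh)"
  using is_functorD(1)[OF horizontal_transformation.functorial[OF assms xh]] hor_ident by simp

lemma eval_hom:
  assumes "globular_modification C (rep C xh) X M"
  shows "MCmp M xh (Ident (HC C) xh) \<in> hom (PCat X xh)
    (fob (TFun (MSrc M) xh) (Ident (HC C) xh)) (fob (TFun (MTgt M) xh) (Ident (HC C) xh))"
  using modif_component[OF assms xh] hor_ident by simp

lemma yoneda_htrans_eval:
  assumes F: "horizontal_transformation C (rep C xh) X F"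
  shows "yoneda_htrans C xh X (fob (TFun F xh) (Ident (HC C) xh)) = F"
proof (rule htrans_eqI[where C = C and X = "rep C xh"], goal_cases)
  case 1
  show ?case by (simp add: yoneda_htrans_def mk_htrans_extensional)
next
  case 2
  show ?case by (rule horizontal_transformation.ext[OF F])
next
  case (3 x g)
  then show ?case using transformation_determined(1)[OF F] by (simp add: yoneda_htrans_sel(1))
next
  case (4 x \<eta>)
  then have "\<eta> \<in> squares C (e x) (tp C \<eta>) (bt C \<eta>) (e xh)" using rep_cat_arr by simp
  then show ?case
    using transformation_determined_glob[OF F 4(1)] yoneda_htrans_sel(2)[OF 4(1)] by simp
next
  case (5 u x x' g g' \<alpha>)
  then show ?case
    using transformation_determined(2)[OF F 5(1)] yoneda_htrans_sel(3)[OF 5(1)] by simp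
qed

lemma eval_functor: "is_functor (psh_hom C (rep C xh) X) (PCat X xh) (eval_at_ident C xh X)"
  unfolding is_functor_def
proof (intro conjI ballI allI impI, goal_cases)
  case (1 F)
  then show ?case using eval_obj by (simp add: eval_at_ident_def)
next
  case (2 F G M)
  then show ?case using eval_hom by (auto simp: eval_at_ident_def)
next
  case (3 F)
  then show ?case using hor_ident xh by (simp add: eval_at_ident_def modif_id_def)
next
  case (4 F G H M N)
  then show ?case using hor_ident xh by (simp add: eval_at_ident_def modif_vcomp_def)
qed

lemma yoneda_functor:
  "is_functor (PCat X xh) (psh_hom C (rep C xh) X)
    \<lparr>fob = yoneda_htrans C xh X, far = yoneda_modif C xh X\<rparr>"
  unfolding is_functor_def
proof (intro conjI ballI allI impI, goal_cases)
  case (1 a)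
  then show ?case using horizontal_transformation_yoneda_htrans by simp
next
  case (2 a b k)
  then show ?case using globular_modification_yoneda_modif yoneda_modif_sel(1,2) by simp
next
  case (3 a)
  note i = category.ident_hom[OF X.cat[OF xh] 3]
  have "yoneda_modif C xh X (Ident (PCat X xh) a) =
      modif_id C (rep C xh) X (yoneda_htrans C xh X a)"
  proof (rule modif_eqI[OF globular_modification_yoneda_modif[OF i]
        modif_id[OF horizontal_transformation_yoneda_htrans[OF 3]]], goal_cases)
    case (3 x g)
    then show ?case
      using is_functorD(2)[OF X.functorial \<open>a \<in> Obj (PCat X xh)\<close>, of g x] yoneda_modif_sel(3)[OF i]
      by (simp add: modif_id_def yoneda_htrans_sel(1))
  qed (simp_all add: yoneda_modif_sel[OF i] modif_id_def)
  then show ?case by simp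
next
  case (4 a b c k l)
  note k = 4(1) and l = 4(2)
  note lk = category.comp_hom[OF X.cat[OF xh] k l]
  have "globular_modification C (rep C xh) X
      (modif_vcomp C (rep C xh) X (yoneda_modif C xh X l) (yoneda_modif C xh X k))"
    using modif_vcomp[OF globular_modification_yoneda_modif[OF k]
        globular_modification_yoneda_modif[OF l]]
    by (simp add: yoneda_modif_sel[OF k] yoneda_modif_sel[OF l])
  then have "yoneda_modif C xh X (Comp (PCat X xh) l k) =
      modif_vcomp C (rep C xh) X (yoneda_modif C xh X l) (yoneda_modif C xh X k)"
  proof (rule modif_eqI[OF globular_modification_yoneda_modif[OF lk]], goal_cases)
    case (3 x g)
    then show ?case
      using is_functorD(3)[OF X.functorial k l, of g x]
      by (simp add: modif_vcomp_def yoneda_modif_sel(3)[OF k] yoneda_modif_sel(3)[OF l]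
          yoneda_modif_sel(3)[OF lk])
  qed (simp_all add: yoneda_modif_sel[OF k] yoneda_modif_sel[OF l] yoneda_modif_sel[OF lk]
      modif_vcomp_def)
  then show ?case by simp
qed

lemma eval_iso: "cat_iso (psh_hom C (rep C xh) X) (PCat X xh) (eval_at_ident C xh X)"
proof -
  let ?Y = "\<lparr>fob = yoneda_htrans C xh X, far = yoneda_modif C xh X\<rparr>"
  have "yoneda_modif C xh X (MCmp M xh (Ident (HC C) xh)) = M"
    if M: "globular_modification C (rep C xh) X M" for M
  proof (rule modif_eqI[OF globular_modification_yoneda_modif[OF eval_hom[OF M]] M], goal_cases)
    case (3 x g)
    then show ?case
      using modification_determined[OF M] yoneda_modif_sel(3)[OF eval_hom[OF M]] by simp
  qed (simp_all add: yoneda_modif_sel[OF eval_hom[OF M]]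
      yoneda_htrans_eval globular_modification.src[OF M] globular_modification.tgt[OF M])
  then have "func_eq (psh_hom C (rep C xh) X) (func_comp ?Y (eval_at_ident C xh X)) id_func"
    by (simp add: func_eq_def func_comp_def id_func_def eval_at_ident_def yoneda_htrans_eval)
  moreover have "func_eq (PCat X xh) (func_comp (eval_at_ident C xh X) ?Y) id_func"
  proof -
    have "MCmp (yoneda_modif C xh X k) xh (Ident (HC C) xh) = k" if "k \<in> Arr (PCat X xh)" for k
      using yoneda_modif_sel(3)[of k _ _ "Ident (HC C) xh" xh] hor_ident X.fun_ident[OF xh] that
      by (simp add: func_eq_def id_func_def hom_def)
    then show ?thesis
      using hor_ident X.fun_ident[OF xh]
      by (simp add: func_eq_def func_comp_def id_func_def eval_at_ident_def yoneda_htrans_sel(1))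
  qed
  ultimately show ?thesis
    unfolding cat_iso_def
    using category_psh_hom X.cat[OF xh] eval_functor yoneda_functor by blast
qed


section \<open>2-naturality\<close>

text \<open>
  As 2-naturality concerns the two variables separately, a cell acting on \<open>C(-,xh)\<close> starts at an
  object \<open>wh\<close> while \<open>X\<close> stays fixed, and a cell acting on \<open>X\<close> ends at a presheaf \<open>Y\<close> while
  \<open>xh\<close> stays fixed. In the first case all evaluations take place at \<open>wh\<close>, where \<open>1\<^sub>w\<^sub>h\<close> is
  carried to \<open>fh\<close>.
\<close>

lemma rep_htrans_ident:
  assumes "fh \<in> hom (HC C) wh xh"
  shows "fob (TFun (rep_htrans C fh) wh) (Ident (HC C) wh) = fh"
proof -
  have "Dom (HC C) fh = wh" using assms by (simp add: hom_def)
  then show ?thesis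
    using category.ident_hom[OF cat_HC horizontal_objects(1)[OF assms]] horizontal_objects[OF assms]
      category.ident_right[OF cat_HC assms]
    by (simp add: rep_htrans_def mk_htrans_sel)
qed

lemma eval_pre_hom:
  assumes fh: "fh \<in> hom (HC C) wh xh"
  shows "func_eq (psh_hom C (rep C xh) X)
    (func_comp (eval_at_ident C wh X) (pre_hom C X fh))
    (func_comp (PFun X fh) (eval_at_ident C xh X))"
proof -
  have dc: "Dom (HC C) fh = wh" "Cod (HC C) fh = xh" using fh by (simp_all add: hom_def)
  note wh = horizontal_objects(1)[OF fh]
  note i = category.ident_hom[OF cat_HC wh]
  have "fob (eval_at_ident C wh X) (fob (pre_hom C X fh) F) =
      fob (PFun X fh) (fob (eval_at_ident C xh X) F)"
    if "horizontal_transformation C (rep C xh) X F" for F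
    using transformation_determined(1)[OF that fh] rep_htrans_ident[OF fh] i wh
    by (simp add: eval_at_ident_def pre_hom_def htrans_comp_def mk_htrans_sel func_comp_def dc Let_def)
  moreover have "far (eval_at_ident C wh X) (far (pre_hom C X fh) M) =
      far (PFun X fh) (far (eval_at_ident C xh X) M)"
    if M: "globular_modification C (rep C xh) X M" for M
  proof -
    have Mf: "MCmp M wh fh \<in> hom (PCat X wh) (fob (TFun (MSrc M) wh) fh) (fob (TFun (MTgt M) wh) fh)"
      using modif_component[OF M wh] fh by simp
    have "far (TFun (MSrc M) wh) (Ident (SV C) fh) = Ident (PCat X wh) (fob (TFun (MSrc M) wh) fh)"
      using is_functorD(2)[OF horizontal_transformation.functorial
          [OF globular_modification.src[OF M] wh], of fh] fh
      by simp
    then show ?thesis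
      using modification_determined[OF M fh] rep_htrans_ident[OF fh] i wh
        category.ident_right[OF X.cat[OF wh] Mf]
      by (simp add: eval_at_ident_def pre_hom_def modif_hcomp_def modif_id_def dc Let_def)
  qed
  ultimately show ?thesis by (simp add: func_eq_def func_comp_def)
qed

text \<open>
  The whiskered component at \<open>1\<^sub>w\<^sub>h\<close> is \<open>F\<^sub>w\<^sub>h\<close> applied to \<open>ah \<circ> e\<^sub>1 = ah\<close>, and \<open>F\<close> on a globular
  square is already known to be the value of that square at \<open>F\<^sub>x\<^sub>h(1\<^sub>x\<^sub>h)\<close>.
\<close>

lemma eval_pre_cell:
  assumes wh: "wh \<in> Ob C" and ah: "ah \<in> squares C (e wh) fh fh' (e xh)"
    and F: "horizontal_transformation C (rep C xh) X F"
  shows "far (eval_at_ident C wh X)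
      (modif_hcomp C (rep C wh) X (modif_id C (rep C xh) X F) (rep_modif C ah)) =
    glob_cmp X xh ah (fob (eval_at_ident C xh X) F)"
proof -
  note fh = squares_boundary[OF ah ver_ident[OF wh] ver_ident[OF xh]]
  have bd: "tp C ah = fh" "bt C ah = fh'" "Dom (HC C) fh = wh"
    using ah fh by (simp_all add: squares_def hom_def)
  note i = category.ident_hom[OF cat_HC wh]
  have ah1: "Comp (SH C) ah (Ident (SV C) (Ident (HC C) wh)) = ah"
    using hcomp_ident(2)[OF ah] ident_ident[OF wh] by simp
  have "far (TFun F wh) ah \<in> hom (PCat X wh) (fob (TFun F wh) fh) (fob (TFun F wh) fh')"
    using is_functor_hom[OF horizontal_transformation.functorial[OF F wh] X_cat[OF wh], of ah] ah
    by simp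
  from category.ident_left[OF X.cat[OF wh] this] show ?thesis
    using transformation_determined_glob[OF F wh ah] rep_htrans_ident[OF fh(2)] i wh fh
    by (simp add: eval_at_ident_def modif_hcomp_def modif_id_def rep_modif_def bd ah1)
qed

lemma eval_post_hom:
  assumes F: "horizontal_transformation C X Y F" and Y: "lax_double_presheaf C Y"
  shows "func_eq (psh_hom C (rep C xh) X)
    (func_comp (eval_at_ident C xh Y) (post_hom C xh X Y F))
    (func_comp (TFun F xh) (eval_at_ident C xh X))"
proof -
  note FF = horizontal_transformation.functorial[OF F xh]
  have "far (eval_at_ident C xh Y) (far (post_hom C xh X Y F) M) =
      far (TFun F xh) (far (eval_at_ident C xh X) M)"
    if M: "globular_modification C (rep C xh) X M" for M
    using category.ident_left[OF lax_double_presheaf.cat[OF Y xh]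
        is_functor_hom[OF FF X.cat[OF xh] eval_hom[OF M]]]
      eval_obj[OF globular_modification.tgt[OF M]] hor_ident xh
    by (simp add: eval_at_ident_def post_hom_def modif_hcomp_def modif_id_def)
  then show ?thesis
    using hor_ident xh
    by (simp add: func_eq_def func_comp_def eval_at_ident_def post_hom_def htrans_comp_def mk_htrans_sel)
qed

lemma eval_post_cell:
  assumes M: "globular_modification C X Y M" and Y: "lax_double_presheaf C Y"
    and F: "horizontal_transformation C (rep C xh) X F"
  shows "far (eval_at_ident C xh Y)
      (modif_hcomp C (rep C xh) Y M (modif_id C (rep C xh) X F)) =
    MCmp M xh (fob (eval_at_ident C xh X) F)"
proof -
  let ?a = "fob (TFun F xh) (Ident (HC C) xh)"
  note a = eval_obj[OF F]
  have "far (TFun (MSrc M) xh) (Ident (PCat X xh) ?a) = Ident (PCat Y xh) (fob (TFun (MSrc M) xh) ?a)"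
    using is_functorD(2)[OF horizontal_transformation.functorial
        [OF globular_modification.src[OF M] xh] a] .
  then show ?thesis
    using category.ident_right[OF lax_double_presheaf.cat[OF Y xh]
        nat_transD(1)[OF globular_modification.natural[OF M xh] a]] hor_ident xh
    by (simp add: eval_at_ident_def modif_hcomp_def modif_id_def)
qed

end

theorem theorem1:
  fixes C :: "('o, 'h, 'v, 's) dcat"
  assumes "double_category C"
  shows "\<exists>\<Phi> :: ('o, 'h, 'v, 's, 'a, 'm) yoneda_family.
    (\<forall>xh \<in> Ob C. \<forall>X. lax_double_presheaf C X \<longrightarrow>
       cat_iso (psh_hom C (rep C xh) X) (PCat X xh) (\<Phi> xh X)) \<and>
    two_natural_in_object C \<Phi> \<and>
    two_natural_in_presheaf C \<Phi>"
proof (intro exI[of _ "eval_at_ident C"] conjI ballI allI impI)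
  have yoneda: "yoneda C X xh" if "lax_double_presheaf C X" "xh \<in> Ob C"
    for X :: "('o, 'h, 'v, 's, 'a, 'm) presheaf" and xh
    using assms that by (intro yoneda.intro yoneda_axioms.intro)
  have ob: "xh \<in> Ob C" "yh \<in> Ob C" if "fh \<in> hom (HC C) xh yh" for fh xh yh
    using category.hom_objects[OF double_category.cat_HC[OF assms] that] .
  show "cat_iso (psh_hom C (rep C xh) X) (PCat X xh) (eval_at_ident C xh X)"
    if "xh \<in> Ob C" "lax_double_presheaf C X"
    for X :: "('o, 'h, 'v, 's, 'a, 'm) presheaf" and xh
    using yoneda.eval_iso[OF yoneda] that by blast
  show "two_natural_in_object C (eval_at_ident C :: ('o, 'h, 'v, 's, 'a, 'm) yoneda_family)"
    unfolding two_natural_in_object_def psh_hom_sel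
    using yoneda.eval_pre_hom[OF yoneda] yoneda.eval_pre_cell[OF yoneda] ob by blast
  show "two_natural_in_presheaf C (eval_at_ident C :: ('o, 'h, 'v, 's, 'a, 'm) yoneda_family)"
    unfolding two_natural_in_presheaf_def psh_hom_sel
    using yoneda.eval_post_hom[OF yoneda] yoneda.eval_post_cell[OF yoneda] by blast
qed

end
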